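(* Let $p$ be a prime and let $G$ be a finite $p$-group of nilpotency class $c$. Let $r$ and $s$ be the integers defined by $exp(G/G')=p^r$ and $exp(Z(G))=p^s$, and let $t=\min\{r,s\}$. Then the exponent of $Aut_{P(G)}(G)$ does not exceed $p^{t^2c-t}$. Moreover, if $G$ is generated by $d$ elements, then for any $p$-subgroup $Q$ of $Aut(G)$ we have $exp(Q) \leq p^{t^2c-t +d-1}$ if $p>2$, and $exp(Q) \leq p^{t^2c-t +2d-1}$ if $p=2$.
   Context: For a group $G$, $exp(G)$ denotes its exponent, $G'=\gamma_2(G)$ its derived subgroup, and $Z(G)$ its center. $P(G)$ denotes $\gamma_2(G)G^4$ if $p=2$ and $\gamma_2(G)G^p$ if $p>2$, where $G^m$ is the subgroup generated by the $m$-th powers of elements of $G$. For a subgroup $N$ of $G$, $Aut_N(G)$ denotes the set of automorphisms $u$ of $G$ such that $x^{-1}u(x)\in N$ for all $x\in G$. *)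

theory Defs
  imports "HOL-Algebra.Algebra" "HOL-Computational_Algebra.Primes"
begin

text \<open>The exponent is only meaningful for groups of finite exponent; for finite groups see
  \<open>group_exponent_pos\<close> and \<open>group_exponent_pow\<close> below.\<close>

definition group_exponent :: "('a, 'b) monoid_scheme \<Rightarrow> nat" where
  "group_exponent G = (LEAST n. 0 < n \<and> (\<forall>x\<in>carrier G. x [^]\<^bsub>G\<^esub> n = \<one>\<^bsub>G\<^esub>))"

definition center :: "('a, 'b) monoid_scheme \<Rightarrow> 'a set" where
  "center G = {z \<in> carrier G. \<forall>x\<in>carrier G. z \<otimes>\<^bsub>G\<^esub> x = x \<otimes>\<^bsub>G\<^esub> z}"

definition commutator_subgroup :: "('a, 'b) monoid_scheme \<Rightarrow> 'a set \<Rightarrow> 'a set \<Rightarrow> 'a set" where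
  "commutator_subgroup G H K = generate G
     (\<Union>h\<in>H. \<Union>k\<in>K. {h \<otimes>\<^bsub>G\<^esub> k \<otimes>\<^bsub>G\<^esub> inv\<^bsub>G\<^esub> h \<otimes>\<^bsub>G\<^esub> inv\<^bsub>G\<^esub> k})"

text \<open>Indexed from 0: \<open>lower_central G i\<close> is the term \<open>\<gamma>\<^sub>i\<^sub>+\<^sub>1(G)\<close> of the lower central series.\<close>

fun lower_central :: "('a, 'b) monoid_scheme \<Rightarrow> nat \<Rightarrow> 'a set" where
  "lower_central G 0 = carrier G"
| "lower_central G (Suc i) = commutator_subgroup G (lower_central G i) (carrier G)"

definition nilpotent_of_class :: "('a, 'b) monoid_scheme \<Rightarrow> nat \<Rightarrow> bool" where
  "nilpotent_of_class G c \<longleftrightarrow>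
     lower_central G c = {\<one>\<^bsub>G\<^esub>} \<and> (\<forall>i<c. lower_central G i \<noteq> {\<one>\<^bsub>G\<^esub>})"

definition power_subgroup :: "('a, 'b) monoid_scheme \<Rightarrow> nat \<Rightarrow> 'a set" where
  "power_subgroup G m = generate G {x [^]\<^bsub>G\<^esub> m | x. x \<in> carrier G}"

definition P_subgroup :: "nat \<Rightarrow> ('a, 'b) monoid_scheme \<Rightarrow> 'a set" where
  "P_subgroup p G =
     derived G (carrier G) <#>\<^bsub>G\<^esub> power_subgroup G (if p = 2 then 4 else p)"

definition Aut_mod :: "('a, 'b) monoid_scheme \<Rightarrow> 'a set \<Rightarrow> ('a \<Rightarrow> 'a) set" where
  "Aut_mod G N = {u \<in> auto G. \<forall>x\<in>carrier G. inv\<^bsub>G\<^esub> x \<otimes>\<^bsub>G\<^esub> u x \<in> N}"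

lemma lower_central_1: "lower_central G (Suc 0) = derived G (carrier G)"
  by (simp add: commutator_subgroup_def derived_def)

lemma (in group) group_exponent_aux:
  assumes "finite (carrier G)"
  shows "0 < group_exponent G \<and> (\<forall>x\<in>carrier G. x [^] group_exponent G = \<one>)"
  unfolding group_exponent_def
proof (rule LeastI)
  show "0 < order G \<and> (\<forall>x\<in>carrier G. x [^] order G = \<one>)"
    using assms by (simp add: order_gt_0_iff_finite pow_order_eq_1)
qed

lemma (in group) group_exponent_pos:
  "finite (carrier G) \<Longrightarrow> 0 < group_exponent G"
  using group_exponent_aux by blast

lemma (in group) group_exponent_pow:
  "finite (carrier G) \<Longrightarrow> x \<in> carrier G \<Longrightarrow> x [^] group_exponent G = \<one>"
  using group_exponent_aux by blast

end

theory Submission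
  imports Defs
begin

text \<open>
The proof rests on the lower exponent-\<open>p\<close> central series \<open>L\<^sub>0 = G\<close>, \<open>L\<^sub>i\<^sub>+\<^sub>1 = [L\<^sub>i, G] L\<^sub>i\<^sup>p\<close>, the fastest
descending central series with elementary abelian factors.

Its length is at most \<open>t c\<close>. All factors of the lower central series have exponent dividing that of
\<open>G/G'\<close>, all factors of the upper central series have exponent dividing that of \<open>Z(G)\<close>. So, whether
\<open>t = r\<close> or \<open>t = s\<close>, there is a central series with \<open>c\<close> factors of exponent dividing \<open>p\<^sup>t\<close>. Every such
factor can be refined to \<open>t\<close> elementary abelian ones, and no central series with elementary abelian
factors descends faster than \<open>L\<close>. This is \<open>lower_p_series_trivial\<close>.

If an endomorphism \<open>u\<close> is trivial on \<open>G/L\<^sub>1\<close>, then it is trivial on every \<open>L\<^sub>i/L\<^sub>i\<^sub>+\<^sub>1\<close>, because the factor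
is generated by the images of commutators and \<open>p\<close>-th powers, which only depend on \<open>L\<^sub>i\<^sub>-\<^sub>1/L\<^sub>i\<close> and
\<open>G/L\<^sub>1\<close> (\<open>endomorphism_lower_p_series\<close>). If moreover \<open>u\<close> is trivial on \<open>G/L\<^sub>i\<close>, then \<open>u x = x y\<close> with
\<open>y \<in> L\<^sub>i\<close> gives \<open>u\<^sup>p x = x y\<^sup>p = x\<close> modulo \<open>L\<^sub>i\<^sub>+\<^sub>1\<close>. Thus each further \<open>p\<close>-th power gains one step of the
series, and after \<open>t c - 1\<close> of them \<open>u\<close> has become the identity. Since \<open>P(G) \<subseteq> L\<^sub>1\<close> and
\<open>t c - 1 \<le> t (t c - 1)\<close> whenever \<open>G\<close> is not trivial, the first bound follows.

For an automorphism \<open>u\<close> of \<open>p\<close>-power order, \<open>G/L\<^sub>1\<close> is a vector space of dimension at most \<open>d\<close> over the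
field with \<open>p\<close> elements, on which \<open>u = 1 + f\<close> satisfies \<open>u\<^sup>q = 1 + f\<^sup>q\<close> for powers \<open>q\<close> of \<open>p\<close>. Hence \<open>f\<close>
is nilpotent, \<open>f\<^sup>d = 0\<close>, and the power of \<open>u\<close> with exponent \<open>p\<^sup>d\<^sup>-\<^sup>1 \<ge> d\<close> is trivial on \<open>G/L\<^sub>1\<close>
(\<open>unipotent_pow_eq_id\<close>). To that power the first part applies, which gives the exponent
\<open>t\<^sup>2 c - t + d - 1\<close>; it is also at most \<open>t\<^sup>2 c - t + 2 d - 1\<close>, the value for \<open>p = 2\<close>.
\<close>

section \<open>Commutators and the lower exponent-p central series\<close>

definition commutator :: "('a, 'b) monoid_scheme \<Rightarrow> 'a \<Rightarrow> 'a \<Rightarrow> 'a" where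
  "commutator G x y = x \<otimes>\<^bsub>G\<^esub> y \<otimes>\<^bsub>G\<^esub> inv\<^bsub>G\<^esub> x \<otimes>\<^bsub>G\<^esub> inv\<^bsub>G\<^esub> y"

text \<open>This is the lower exponent-\<open>p\<close> central series, indexed from \<open>0\<close>: the fastest descending central
series with elementary abelian factors. Its second term, at index \<open>1\<close>, is \<open>G' G\<^sup>p\<close>, the Frattini
subgroup when \<open>G\<close> is a finite \<open>p\<close>-group.\<close>

fun lower_p_series :: "nat \<Rightarrow> ('a, 'b) monoid_scheme \<Rightarrow> nat \<Rightarrow> 'a set" where
  "lower_p_series p G 0 = carrier G"
| "lower_p_series p G (Suc i) = generate G
     ({commutator G x g | x g. x \<in> lower_p_series p G i \<and> g \<in> carrier G}
      \<union> {x [^]\<^bsub>G\<^esub> p | x. x \<in> lower_p_series p G i})"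

context group
begin

lemma inv_mult_cancel [simp]:
  assumes "x \<in> carrier G" "y \<in> carrier G"
  shows "inv x \<otimes> (x \<otimes> y) = y" "x \<otimes> (inv x \<otimes> y) = y"
  using assms by (simp_all add: m_assoc[symmetric])

lemma commutator_closed [simp]:
  "x \<in> carrier G \<Longrightarrow> y \<in> carrier G \<Longrightarrow> commutator G x y \<in> carrier G"
  by (simp add: commutator_def)

lemma commutator_eqI:
  assumes "x \<in> carrier G" "y \<in> carrier G" "z \<in> carrier G" "x \<otimes> y = z \<otimes> (y \<otimes> x)"
  shows "commutator G x y = z"
  using assms by (simp add: commutator_def m_assoc)

lemma mult_eq_commutator:
  assumes "x \<in> carrier G" "y \<in> carrier G"
  shows "x \<otimes> y = commutator G x y \<otimes> (y \<otimes> x)"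
  using assms by (simp add: commutator_def m_assoc)

lemma commutator_eq_one_iff:
  assumes "x \<in> carrier G" "y \<in> carrier G"
  shows "commutator G x y = \<one> \<longleftrightarrow> x \<otimes> y = y \<otimes> x"
  using assms commutator_eqI[of x y \<one>] mult_eq_commutator[of x y]
  by (metis l_one m_closed one_closed)

lemma inv_commutator:
  assumes "x \<in> carrier G" "y \<in> carrier G"
  shows "inv (commutator G x y) = commutator G y x"
  using assms by (simp add: commutator_def inv_mult_group m_assoc)

text \<open>Moving the factors of \<open>x\<^sup>n\<close> past \<open>g\<close> one at a time leaves behind \<open>n\<close> copies of \<open>[x, g]\<close>, which may be
collected on the left because they commute with \<open>x\<close>.\<close>

lemma commutator_pow:
  assumes x: "x \<in> carrier G" and g: "g \<in> carrier G"
    and comm: "x \<otimes> commutator G x g = commutator G x g \<otimes> x"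
  shows "commutator G (x [^] n) g = commutator G x g [^] (n::nat)"
proof (rule commutator_eqI)
  define z where "z = commutator G x g"
  have z: "z \<in> carrier G" and xg: "x \<otimes> g = z \<otimes> (g \<otimes> x)" and xz: "x \<otimes> z = z \<otimes> x"
    using x g comm mult_eq_commutator[OF x g] by (auto simp only: z_def commutator_closed)
  have "x [^] n \<otimes> g = z [^] n \<otimes> (g \<otimes> x [^] n)"
  proof (induction n)
    case 0
    then show ?case using g by simp
  next
    case (Suc n)
    have "x [^] Suc n \<otimes> g = x [^] n \<otimes> (z \<otimes> (g \<otimes> x))"
      using x g by (simp add: m_assoc xg)
    also have "\<dots> = z \<otimes> (x [^] n \<otimes> g) \<otimes> x"
    proof -
      have "x [^] n \<otimes> z = z \<otimes> x [^] n"
        using group_commutes_pow[OF xz x z] .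
      then have "x [^] n \<otimes> z \<otimes> (g \<otimes> x) = z \<otimes> x [^] n \<otimes> (g \<otimes> x)"
        by simp
      then show ?thesis using x g z by (simp add: m_assoc)
    qed
    also have "\<dots> = z \<otimes> z [^] n \<otimes> (g \<otimes> (x [^] n \<otimes> x))"
      using x g z by (simp add: Suc.IH m_assoc del: nat_pow_Suc)
    also have "\<dots> = z [^] Suc n \<otimes> (g \<otimes> x [^] Suc n)"
      using z nat_pow_Suc2[of z n] by simp
    finally show ?case .
  qed
  then show "x [^] n \<otimes> g = commutator G x g [^] n \<otimes> (g \<otimes> x [^] n)"
    by (simp add: z_def)
qed (use x g in auto)

lemma inv_mult_eq_one_iff:
  assumes "x \<in> carrier G" "y \<in> carrier G"
  shows "inv x \<otimes> y = \<one> \<longleftrightarrow> x = y"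
  using assms by (metis inv_closed inv_equality inv_inv l_inv)

lemma normal_if_commutators_in:
  assumes "subgroup N G" and comm: "\<And>x g. x \<in> N \<Longrightarrow> g \<in> carrier G \<Longrightarrow> commutator G x g \<in> N"
  shows "N \<lhd> G"
proof (rule normal_invI[OF assms(1)])
  interpret N: subgroup N G by fact
  fix g x assume g: "g \<in> carrier G" and x: "x \<in> N"
  have "commutator G g x \<otimes> x \<in> N"
    using comm[OF x g] g x inv_commutator[of x g] N.m_closed N.m_inv_closed N.mem_carrier by metis
  also have "commutator G g x \<otimes> x = g \<otimes> x \<otimes> inv g"
    using g x N.mem_carrier by (simp add: commutator_def m_assoc)
  finally show "g \<otimes> x \<otimes> inv g \<in> N" .
qed

end

section \<open>Passing to quotients\<close>

lemma (in group_hom) hom_commutator: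
  "x \<in> carrier G \<Longrightarrow> y \<in> carrier G \<Longrightarrow> h (commutator G x y) = commutator H (h x) (h y)"
  by (simp add: commutator_def)

text \<open>A property of elements that generate a subgroup is extended to the whole subgroup by showing that
the elements with the property form a subgroup. This lemma and the next provide such subgroups: for
the identity map and \<open>A\<close> the whole group it is the centre, and for a quotient map the set of
elements commuting with \<open>A\<close> modulo the kernel.\<close>

lemma (in group_hom) subgroup_commuting_images:
  assumes "A \<subseteq> carrier G"
  shows "subgroup {x \<in> carrier G. \<forall>a\<in>A. h a \<otimes>\<^bsub>H\<^esub> h x = h x \<otimes>\<^bsub>H\<^esub> h a} G"
proof (rule G.subgroupI, goal_cases)
  case 1
  then show ?case by auto
next
  case 2
  then show ?case using assms by (auto intro!: exI[of _ \<one>])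
next
  case (3 x)
  have "h a \<otimes>\<^bsub>H\<^esub> h (inv x) = h (inv x) \<otimes>\<^bsub>H\<^esub> h a" if "a \<in> A" for a
  proof -
    have a: "a \<in> carrier G" and x: "x \<in> carrier G" and eq: "h a \<otimes>\<^bsub>H\<^esub> h x = h x \<otimes>\<^bsub>H\<^esub> h a"
      using 3 that assms by auto
    have "h a \<otimes>\<^bsub>H\<^esub> h (inv x) = inv\<^bsub>H\<^esub> h x \<otimes>\<^bsub>H\<^esub> (h x \<otimes>\<^bsub>H\<^esub> h a) \<otimes>\<^bsub>H\<^esub> inv\<^bsub>H\<^esub> h x"
      using a x by simp
    also have "\<dots> = h (inv x) \<otimes>\<^bsub>H\<^esub> h a"
      unfolding eq[symmetric] using a x by (simp add: H.m_assoc)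
    finally show ?thesis .
  qed
  then show ?case using 3 by simp
next
  case (4 x y)
  have "h a \<otimes>\<^bsub>H\<^esub> h (x \<otimes> y) = h (x \<otimes> y) \<otimes>\<^bsub>H\<^esub> h a" if "a \<in> A" for a
  proof -
    have a: "a \<in> carrier G" "x \<in> carrier G" "y \<in> carrier G"
      and eq: "h a \<otimes>\<^bsub>H\<^esub> h x = h x \<otimes>\<^bsub>H\<^esub> h a" "h a \<otimes>\<^bsub>H\<^esub> h y = h y \<otimes>\<^bsub>H\<^esub> h a"
      using 4 that assms by auto
    have "h a \<otimes>\<^bsub>H\<^esub> h (x \<otimes> y) = h x \<otimes>\<^bsub>H\<^esub> (h a \<otimes>\<^bsub>H\<^esub> h y)"
      using a eq(1) by (simp add: H.m_assoc[symmetric])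
    also have "\<dots> = h (x \<otimes> y) \<otimes>\<^bsub>H\<^esub> h a"
      using a eq(2) by (simp add: H.m_assoc)
    finally show ?thesis .
  qed
  then show ?case using 4 by simp
qed

lemma (in group) subgroup_equalizer:
  assumes "group_hom G K f" "group_hom G K g" "subgroup H G"
  shows "subgroup {x \<in> H. f x = g x} G"
proof -
  interpret f: group_hom G K f by fact
  interpret g: group_hom G K g by fact
  interpret H: subgroup H G by fact
  show ?thesis
    using H.one_closed by (intro subgroupI) (auto intro!: exI[of _ \<one>])
qed

lemma (in normal) quotient_map_hom: "group_hom G (G Mod H) (\<lambda>x. H #> x)"
  by (simp add: factorgroup_is_group group_hom_axioms_def group_hom_def is_group r_coset_hom_Mod)

lemma (in normal) quotient_map_eq_one_iff:
  "x \<in> carrier G \<Longrightarrow> H #> x = \<one>\<^bsub>G Mod H\<^esub> \<longleftrightarrow> x \<in> H"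
  using coset_join1[of H x] coset_join2[of x H] is_subgroup by auto

lemma (in normal) quotient_map_eq_iff:
  assumes "x \<in> carrier G" "y \<in> carrier G"
  shows "H #> x = H #> y \<longleftrightarrow> inv x \<otimes> y \<in> H"
proof -
  interpret q: group_hom G "G Mod H" "\<lambda>x. H #> x" by (rule quotient_map_hom)
  have "inv x \<otimes> y \<in> H \<longleftrightarrow> H #> (inv x \<otimes> y) = \<one>\<^bsub>G Mod H\<^esub>"
    using assms by (intro quotient_map_eq_one_iff[symmetric]) auto
  also have "\<dots> \<longleftrightarrow> inv\<^bsub>G Mod H\<^esub> (H #> x) \<otimes>\<^bsub>G Mod H\<^esub> (H #> y) = \<one>\<^bsub>G Mod H\<^esub>"
    using assms q.hom_mult[of "inv x" y] q.hom_inv[of x] by (simp del: mult_FactGroup one_FactGroup)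
  also have "\<dots> \<longleftrightarrow> H #> x = H #> y"
    using assms q.hom_closed by (intro q.H.inv_mult_eq_one_iff) auto
  finally show ?thesis by blast
qed

text \<open>Statements of the form \<open>[x, g] \<in> N\<close> are handled below by passing to the quotient by \<open>N\<close>, where they
become commutation.\<close>

lemma (in normal) commute_mod_iff:
  assumes "x \<in> carrier G" "g \<in> carrier G"
  shows "(H #> x) \<otimes>\<^bsub>G Mod H\<^esub> (H #> g) = (H #> g) \<otimes>\<^bsub>G Mod H\<^esub> (H #> x) \<longleftrightarrow> commutator G x g \<in> H"
proof -
  interpret q: group_hom G "G Mod H" "\<lambda>x. H #> x" by (rule quotient_map_hom)
  have "commutator G x g \<in> H \<longleftrightarrow> H #> commutator G x g = \<one>\<^bsub>G Mod H\<^esub>"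
    using assms by (intro quotient_map_eq_one_iff[symmetric] commutator_closed)
  also have "\<dots> \<longleftrightarrow> commutator (G Mod H) (H #> x) (H #> g) = \<one>\<^bsub>G Mod H\<^esub>"
    by (simp only: q.hom_commutator[OF assms])
  also have "\<dots> \<longleftrightarrow> (H #> x) \<otimes>\<^bsub>G Mod H\<^esub> (H #> g) = (H #> g) \<otimes>\<^bsub>G Mod H\<^esub> (H #> x)"
    using assms by (intro q.H.commutator_eq_one_iff q.hom_closed)
  finally show ?thesis by blast
qed

section \<open>Central series with bounded factors\<close>

context group
begin

lemma commutator_pow_in_iff:
  assumes "N \<lhd> G" and x: "x \<in> carrier G" and g: "g \<in> carrier G"
    and comm: "commutator G (commutator G x g) x \<in> N"
  shows "commutator G (x [^] n) g \<in> N \<longleftrightarrow> commutator G x g [^] (n::nat) \<in> N"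
proof -
  interpret normal N G by fact
  interpret q: group_hom G "G Mod N" "\<lambda>x. N #> x" by (rule quotient_map_hom)
  have img: "N #> x \<in> carrier (G Mod N)" "N #> g \<in> carrier (G Mod N)"
    using x g by (intro q.hom_closed; simp)+
  have eq: "commutator (G Mod N) ((N #> x) [^]\<^bsub>G Mod N\<^esub> n) (N #> g)
      = commutator (G Mod N) (N #> x) (N #> g) [^]\<^bsub>G Mod N\<^esub> n"
  proof (rule q.H.commutator_pow[OF img])
    show "(N #> x) \<otimes>\<^bsub>G Mod N\<^esub> commutator (G Mod N) (N #> x) (N #> g)
        = commutator (G Mod N) (N #> x) (N #> g) \<otimes>\<^bsub>G Mod N\<^esub> (N #> x)"
      using commute_mod_iff[of "commutator G x g" x] comm x g
      by (simp only: q.hom_commutator commutator_closed simp_thms)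
  qed
  have "commutator G (x [^] n) g \<in> N \<longleftrightarrow> N #> commutator G (x [^] n) g = \<one>\<^bsub>G Mod N\<^esub>"
    using x g by (intro quotient_map_eq_one_iff[symmetric]) auto
  also have "N #> commutator G (x [^] n) g = N #> (commutator G x g [^] n)"
    using x g eq by (simp only: q.hom_commutator q.hom_nat_pow nat_pow_closed commutator_closed)
  also have "N #> (commutator G x g [^] n) = \<one>\<^bsub>G Mod N\<^esub> \<longleftrightarrow> commutator G x g [^] n \<in> N"
    using x g by (intro quotient_map_eq_one_iff) auto
  finally show ?thesis .
qed

lemma subgroup_nat_pow_closed: "subgroup H G \<Longrightarrow> x \<in> H \<Longrightarrow> x [^] (n::nat) \<in> H"
  using subgroup_int_pow_closed[of H x "int n"] by (simp add: int_pow_int)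

text \<open>Modulo \<open>N\<close> the subgroup \<open>H\<close> is abelian, so taking \<open>n\<close>-th powers is a homomorphism on it.\<close>

lemma subgroup_powers_in:
  assumes "subgroup H G" "N \<lhd> G"
    and comm: "\<And>x y. x \<in> H \<Longrightarrow> y \<in> H \<Longrightarrow> commutator G x y \<in> N"
  shows "subgroup {x \<in> H. x [^] (n::nat) \<in> N} G"
proof -
  interpret H: subgroup H G by fact
  interpret normal N G by fact
  interpret q: group_hom G "G Mod N" "\<lambda>x. N #> x" by (rule quotient_map_hom)
  have pow: "x [^] n \<in> N \<longleftrightarrow> (N #> x) [^]\<^bsub>G Mod N\<^esub> n = \<one>\<^bsub>G Mod N\<^esub>" if "x \<in> H" for x
    using that by (simp only: quotient_map_eq_one_iff nat_pow_closed H.mem_carrier flip: q.hom_nat_pow)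
  show ?thesis
  proof (rule subgroupI, goal_cases)
    case (3 x)
    then show ?case by (auto simp: nat_pow_inv)
  next
    case (4 x y)
    then have xy: "x \<in> carrier G" "y \<in> carrier G" "x \<in> H" "y \<in> H" by auto
    have "(N #> (x \<otimes> y)) [^]\<^bsub>G Mod N\<^esub> n
        = (N #> x) [^]\<^bsub>G Mod N\<^esub> n \<otimes>\<^bsub>G Mod N\<^esub> (N #> y) [^]\<^bsub>G Mod N\<^esub> n"
      using xy comm commute_mod_iff[of x y]
      by (simp only: q.hom_mult q.hom_closed q.H.pow_mult_distrib)
    also have "\<dots> = \<one>\<^bsub>G Mod N\<^esub>"
    proof -
      have "(N #> x) [^]\<^bsub>G Mod N\<^esub> n = \<one>\<^bsub>G Mod N\<^esub>" "(N #> y) [^]\<^bsub>G Mod N\<^esub> n = \<one>\<^bsub>G Mod N\<^esub>"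
        using 4 pow by blast+
      then show ?thesis by (simp only: q.H.l_one q.H.one_closed)
    qed
    finally show ?case using xy pow[of "x \<otimes> y"] by blast
  qed (use H.one_closed in \<open>auto intro!: exI[of _ \<one>]\<close>)
qed

lemma subgroup_lower_p_series: "subgroup (lower_p_series p G i) G"
proof (induction i)
  case 0
  show ?case by (simp add: subgroup_self)
next
  case (Suc i)
  then show ?case
    by (auto intro!: generate_is_subgroup dest: subgroup.mem_carrier)
qed

declare lower_p_series.simps(2) [simp del]

lemma lower_p_series_carrier [simp]: "x \<in> lower_p_series p G i \<Longrightarrow> x \<in> carrier G"
  by (rule subgroup.mem_carrier[OF subgroup_lower_p_series])

lemma commutator_in_lower_p_series_Suc:
  "x \<in> lower_p_series p G i \<Longrightarrow> g \<in> carrier G \<Longrightarrow> commutator G x g \<in> lower_p_series p G (Suc i)"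
  unfolding lower_p_series.simps by (rule generate.incl) blast

lemma pow_in_lower_p_series_Suc:
  "x \<in> lower_p_series p G i \<Longrightarrow> x [^] p \<in> lower_p_series p G (Suc i)"
  unfolding lower_p_series.simps by (rule generate.incl) blast

lemma lower_p_series_Suc_least:
  assumes "subgroup K G"
    and "\<And>x g. x \<in> lower_p_series p G i \<Longrightarrow> g \<in> carrier G \<Longrightarrow> commutator G x g \<in> K"
    and "\<And>x. x \<in> lower_p_series p G i \<Longrightarrow> x [^] p \<in> K"
  shows "lower_p_series p G (Suc i) \<subseteq> K"
  unfolding lower_p_series.simps
  by (rule generate_subgroup_incl[OF _ assms(1)]) (use assms(2,3) in auto)

lemma lower_p_series_Suc_subset: "lower_p_series p G (Suc i) \<subseteq> lower_p_series p G i"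
proof (induction i)
  case 0
  show ?case by (auto simp del: lower_p_series.simps(2))
next
  case (Suc i)
  show ?case
  proof (rule lower_p_series_Suc_least[OF subgroup_lower_p_series])
    fix x assume "x \<in> lower_p_series p G (Suc i)"
    then have x: "x \<in> lower_p_series p G i" using Suc by blast
    show "x [^] p \<in> lower_p_series p G (Suc i)"
      by (rule pow_in_lower_p_series_Suc[OF x])
    show "commutator G x g \<in> lower_p_series p G (Suc i)" if "g \<in> carrier G" for g
      by (rule commutator_in_lower_p_series_Suc[OF x that])
  qed
qed

lemma lower_p_series_antimono: "i \<le> j \<Longrightarrow> lower_p_series p G j \<subseteq> lower_p_series p G i"
  by (rule lift_Suc_antimono_le[of "lower_p_series p G"]) (rule lower_p_series_Suc_subset)

lemma normal_lower_p_series: "lower_p_series p G i \<lhd> G"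
  by (rule normal_if_commutators_in[OF subgroup_lower_p_series],
      rule subsetD[OF lower_p_series_Suc_subset], rule commutator_in_lower_p_series_Suc)

text \<open>A central factor \<open>H/N\<close> of exponent dividing \<open>p\<^sup>k\<close> costs at most \<open>k\<close> steps of the series: it is refined
by the subgroups of those elements of \<open>H\<close> whose \<open>p\<^sup>k\<^sup>-\<^sup>j\<close>-th power lies in \<open>N\<close>, for \<open>j = 0, \<dots>, k\<close>.
Each of these factors is central and elementary abelian, and the series descends at least as fast.\<close>

lemma lower_p_series_refine:
  assumes H: "subgroup H G" and N: "subgroup N G" "N \<subseteq> H"
    and comm: "\<And>x g. x \<in> H \<Longrightarrow> g \<in> carrier G \<Longrightarrow> commutator G x g \<in> N"
    and pow: "\<And>x. x \<in> H \<Longrightarrow> x [^] (p ^ k) \<in> N"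
    and m: "lower_p_series p G m \<subseteq> H"
  shows "lower_p_series p G (m + k) \<subseteq> N"
proof -
  interpret H: subgroup H G by fact
  interpret N: subgroup N G by fact
  have N_normal: "N \<lhd> G"
    using N comm by (intro normal_if_commutators_in) auto
  have "lower_p_series p G (m + j) \<subseteq> {x \<in> H. x [^] (p ^ (k - j)) \<in> N}" if "j \<le> k" for j
    using that
  proof (induction j)
    case 0
    then show ?case using m pow by auto
  next
    case (Suc j)
    have "lower_p_series p G (Suc (m + j)) \<subseteq> {x \<in> H. x [^] (p ^ (k - Suc j)) \<in> N}"
    proof (rule lower_p_series_Suc_least)
      show "subgroup {x \<in> H. x [^] (p ^ (k - Suc j)) \<in> N} G"
        using comm by (intro subgroup_powers_in[OF H N_normal]) auto
      fix x assume "x \<in> lower_p_series p G (m + j)"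
      then have x: "x \<in> H" "x [^] (p ^ (k - j)) \<in> N" using Suc by auto
      have "p * p ^ (k - Suc j) = p ^ (k - j)"
        using Suc.prems by (metis Suc_diff_Suc Suc_le_lessD power_Suc)
      then show "x [^] p \<in> {x \<in> H. x [^] (p ^ (k - Suc j)) \<in> N}"
        using x by (auto simp: nat_pow_pow intro: subgroup_nat_pow_closed[OF H])
      show "commutator G x g \<in> {x \<in> H. x [^] (p ^ (k - Suc j)) \<in> N}" if "g \<in> carrier G" for g
        using comm[OF x(1) that] N by (auto intro: subgroup_nat_pow_closed)
    qed
    then show ?case by simp
  qed
  from this[of k] show ?thesis by auto
qed

lemma lower_p_series_subset_central_series:
  assumes "H 0 = carrier G" and "\<And>i. subgroup (H i) G"
    and "\<And>i. H (Suc i) \<subseteq> H i"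
    and "\<And>i x g. x \<in> H i \<Longrightarrow> g \<in> carrier G \<Longrightarrow> commutator G x g \<in> H (Suc i)"
    and "\<And>i x. x \<in> H i \<Longrightarrow> x [^] (p ^ k) \<in> H (Suc i)"
  shows "lower_p_series p G (k * i) \<subseteq> H i"
proof (induction i)
  case 0
  then show ?case by (auto simp: assms(1))
next
  case (Suc i)
  have "lower_p_series p G (k * i + k) \<subseteq> H (Suc i)"
    by (rule lower_p_series_refine[OF assms(2) assms(2) assms(3,4,5) Suc])
  then show ?case by (simp add: add.commute)
qed

lemma subgroup_lower_central: "subgroup (lower_central G i) G"
proof (induction i)
  case 0
  show ?case by (simp add: subgroup_self)
next
  case (Suc i)
  then show ?case
    by (auto simp: commutator_subgroup_def intro!: generate_is_subgroup dest: subgroup.mem_carrier)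
qed

lemma lower_central_carrier [simp]: "x \<in> lower_central G i \<Longrightarrow> x \<in> carrier G"
  by (rule subgroup.mem_carrier[OF subgroup_lower_central])

lemma commutator_in_lower_central_Suc:
  "x \<in> lower_central G i \<Longrightarrow> g \<in> carrier G \<Longrightarrow> commutator G x g \<in> lower_central G (Suc i)"
  unfolding lower_central.simps commutator_subgroup_def commutator_def
  by (rule generate.incl) blast

lemma lower_central_Suc_least:
  assumes "subgroup K G"
    and "\<And>x g. x \<in> lower_central G i \<Longrightarrow> g \<in> carrier G \<Longrightarrow> commutator G x g \<in> K"
  shows "lower_central G (Suc i) \<subseteq> K"
  unfolding lower_central.simps commutator_subgroup_def commutator_def[symmetric]
  by (rule generate_subgroup_incl[OF _ assms(1)]) (use assms(2) in auto)

lemma lower_central_Suc_subset: "lower_central G (Suc i) \<subseteq> lower_central G i"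
proof (induction i)
  case 0
  show ?case by (auto simp del: lower_central.simps(2))
next
  case (Suc i)
  show ?case
    by (rule lower_central_Suc_least[OF subgroup_lower_central],
        rule commutator_in_lower_central_Suc) (use Suc in blast)+
qed

lemma normal_lower_central: "lower_central G i \<lhd> G"
  by (rule normal_if_commutators_in[OF subgroup_lower_central],
      rule subsetD[OF lower_central_Suc_subset], rule commutator_in_lower_central_Suc)

text \<open>The exponent of \<open>G/G'\<close> bounds that of every lower central factor: a factor is generated by
commutators \<open>[x, g]\<close> with \<open>x\<close> in the previous term, and modulo the next term
\<open>[x, g]\<^sup>n = [x\<^sup>n, g]\<close>, where \<open>x\<^sup>n\<close> has already moved down by one step.\<close>

lemma pow_lower_central:
  assumes ab: "\<And>x. x \<in> carrier G \<Longrightarrow> x [^] (n::nat) \<in> lower_central G (Suc 0)"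
    and "x \<in> lower_central G i"
  shows "x [^] n \<in> lower_central G (Suc i)"
  using assms(2)
proof (induction i arbitrary: x)
  case 0
  then show ?case using ab by simp
next
  case (Suc i)
  define K where "K = {x \<in> lower_central G (Suc i). x [^] n \<in> lower_central G (Suc (Suc i))}"
  have "lower_central G (Suc i) \<subseteq> K"
  proof (rule lower_central_Suc_least)
    show "subgroup K G"
      unfolding K_def
      by (rule subgroup_powers_in[OF subgroup_lower_central normal_lower_central],
          rule commutator_in_lower_central_Suc, assumption, rule lower_central_carrier)
    fix x g assume x: "x \<in> lower_central G i" and g: "g \<in> carrier G"
    have xc: "x \<in> carrier G" by (rule lower_central_carrier[OF x])
    have xg: "commutator G x g \<in> lower_central G (Suc i)"
      by (rule commutator_in_lower_central_Suc[OF x g])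
    have "commutator G (x [^] n) g \<in> lower_central G (Suc (Suc i))"
      by (rule commutator_in_lower_central_Suc[OF Suc.IH[OF x] g])
    then have "commutator G x g [^] n \<in> lower_central G (Suc (Suc i))"
      using commutator_pow_in_iff[OF normal_lower_central xc g commutator_in_lower_central_Suc[OF xg xc]]
      by blast
    then show "commutator G x g \<in> K"
      using xg by (simp add: K_def del: lower_central.simps)
  qed
  then show ?case using Suc.prems unfolding K_def by blast
qed

end

fun upper_central :: "('a, 'b) monoid_scheme \<Rightarrow> nat \<Rightarrow> 'a set" where
  "upper_central G 0 = {\<one>\<^bsub>G\<^esub>}"
| "upper_central G (Suc i)
     = {x \<in> carrier G. \<forall>g\<in>carrier G. commutator G x g \<in> upper_central G i}"

context group
begin

lemma upper_central_carrier [simp]: "x \<in> upper_central G i \<Longrightarrow> x \<in> carrier G"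
  by (cases i) auto

lemma normal_upper_central: "upper_central G i \<lhd> G"
  and upper_central_subset_Suc: "upper_central G i \<subseteq> upper_central G (Suc i)"
proof (induction i)
  case 0
  {
    case 1
    show ?case by (simp add: one_is_normal)
  next
    case 2
    show ?case by (auto simp: commutator_eq_one_iff)
  }
next
  case (Suc i)
  have n: "upper_central G i \<lhd> G" by (rule Suc.IH)
  interpret normal "upper_central G i" G by (rule n)
  interpret q: group_hom G "G Mod upper_central G i" "\<lambda>x. upper_central G i #> x"
    by (rule quotient_map_hom)
  have "upper_central G (Suc i) = {x \<in> carrier G. \<forall>a\<in>carrier G.
      (upper_central G i #> a) \<otimes>\<^bsub>G Mod upper_central G i\<^esub> (upper_central G i #> x)
      = (upper_central G i #> x) \<otimes>\<^bsub>G Mod upper_central G i\<^esub> (upper_central G i #> a)}"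
    using commute_mod_iff by (auto simp del: mult_FactGroup)
  then have sub: "subgroup (upper_central G (Suc i)) G"
    using q.subgroup_commuting_images[of "carrier G"] by simp
  {
    case 1
    show ?case
    proof (rule normal_if_commutators_in[OF sub])
      fix x g assume "x \<in> upper_central G (Suc i)" "g \<in> carrier G"
      then have "commutator G x g \<in> upper_central G i" by simp
      then show "commutator G x g \<in> upper_central G (Suc i)"
        using Suc.IH(2) by blast
    qed
  next
    case 2
    show ?case
    proof
      fix x assume "x \<in> upper_central G (Suc i)"
      then have "x \<in> carrier G" "\<forall>g\<in>carrier G. commutator G x g \<in> upper_central G (Suc i)"
        using Suc.IH(2) by auto
      then show "x \<in> upper_central G (Suc (Suc i))" by simp
    qed
  }
qed

text \<open>Dually, the exponent of the centre bounds that of every upper central factor: \<open>[x\<^sup>n, g] = [x, g]\<^sup>n\<close>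
one level down, and there the claim holds by induction.\<close>

lemma pow_upper_central:
  assumes center: "\<And>z. z \<in> center G \<Longrightarrow> z [^] (n::nat) = \<one>"
    and "x \<in> upper_central G (Suc i)"
  shows "x [^] n \<in> upper_central G i"
  using assms(2)
proof (induction i arbitrary: x)
  case 0
  then have "x \<in> center G"
    by (auto simp: center_def commutator_eq_one_iff)
  then show ?case using center by simp
next
  case (Suc i)
  have x: "x \<in> carrier G" using Suc.prems by simp
  have "commutator G (x [^] n) g \<in> upper_central G i" if g: "g \<in> carrier G" for g
  proof -
    have xg: "commutator G x g \<in> upper_central G (Suc i)"
      using Suc.prems g by simp
    then have "commutator G (commutator G x g) x \<in> upper_central G i"
      using x by simp
    then show ?thesis
      using commutator_pow_in_iff[OF normal_upper_central x g] Suc.IH[OF xg] by blast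
  qed
  then show ?case using x by simp
qed

lemma lower_central_subset_upper_central:
  assumes "lower_central G c = {\<one>}" "i \<le> c"
  shows "lower_central G i \<subseteq> upper_central G (c - i)"
  using assms(2)
proof (induction "c - i" arbitrary: i)
  case 0
  then show ?case using assms(1) by simp
next
  case (Suc k)
  have "c - i = Suc (c - Suc i)" using Suc by simp
  moreover have "lower_central G (Suc i) \<subseteq> upper_central G (c - Suc i)"
    using Suc by (intro Suc.hyps(1)) auto
  ultimately show ?case
    using commutator_in_lower_central_Suc by auto
qed

text \<open>The first alternative uses the lower central series, the second the upper central series; both have
\<open>c\<close> factors, and in the respective case each of them has exponent dividing \<open>p\<^sup>t\<close>.\<close>

theorem lower_p_series_trivial:
  assumes nil: "lower_central G c = {\<one>}"
    and exp: "(\<forall>x\<in>carrier G. x [^] (p ^ t) \<in> derived G (carrier G)) \<or> (\<forall>z\<in>center G. z [^] (p ^ t) = \<one>)"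
  shows "lower_p_series p G (t * c) = {\<one>}"
proof -
  have "lower_p_series p G (t * c) \<subseteq> {\<one>}"
    using exp
  proof
    assume "\<forall>x\<in>carrier G. x [^] (p ^ t) \<in> derived G (carrier G)"
    then have "x [^] (p ^ t) \<in> lower_central G (Suc 0)" if "x \<in> carrier G" for x
      using that lower_central_1[of G] by simp
    then have pow: "x [^] (p ^ t) \<in> lower_central G (Suc i)" if "x \<in> lower_central G i" for x i
      using pow_lower_central that by blast
    have "lower_p_series p G (t * c) \<subseteq> lower_central G c"
    proof (rule lower_p_series_subset_central_series[where H = "lower_central G"])
      show "lower_central G 0 = carrier G" by simp
    qed (fact subgroup_lower_central lower_central_Suc_subset commutator_in_lower_central_Suc pow)+
    then show ?thesis using nil by simp
  next
    assume center: "\<forall>z\<in>center G. z [^] (p ^ t) = \<one>"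
    have Suc_diff: "c - i = Suc (c - Suc i)" if "i < c" for i using that by simp
    \<comment> \<open>the upper central series is turned into a descending one by reversing its index\<close>
    have top: "upper_central G c = carrier G"
      using lower_central_subset_upper_central[OF nil, of 0] by auto
    have sub: "upper_central G (c - Suc i) \<subseteq> upper_central G (c - i)" for i
    proof (cases "i < c")
      case True
      then show ?thesis using upper_central_subset_Suc[of "c - Suc i"] by (simp only: Suc_diff[OF True])
    qed simp
    have comm: "commutator G x g \<in> upper_central G (c - Suc i)"
      if "x \<in> upper_central G (c - i)" "g \<in> carrier G" for i x g
    proof (cases "i < c")
      case True
      then show ?thesis using that by (simp only: Suc_diff[OF True]) simp
    next
      case False
      then show ?thesis using that by (simp add: commutator_eq_one_iff)
    qed
    have pow: "x [^] (p ^ t) \<in> upper_central G (c - Suc i)"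
      if "x \<in> upper_central G (c - i)" for i x
    proof (cases "i < c")
      case True
      then show ?thesis using that center by (intro pow_upper_central) (simp_all only: Suc_diff[OF True])
    next
      case False
      then show ?thesis using that by simp
    qed
    have "lower_p_series p G (t * c) \<subseteq> upper_central G (c - c)"
    proof (rule lower_p_series_subset_central_series[where H = "\<lambda>i. upper_central G (c - i)"])
      show "upper_central G (c - 0) = carrier G"
        using top by simp
    qed (fact normal_imp_subgroup[OF normal_upper_central] sub comm pow)+
    then show ?thesis by simp
  qed
  then show ?thesis
    using subgroup.one_closed[OF subgroup_lower_p_series] by blast
qed

end

section \<open>Endomorphisms that are trivial on the first factor\<close>

context group
begin

lemma commutator_mult_right:
  assumes "x \<in> carrier G" "a \<in> carrier G" "b \<in> carrier G"
  shows "commutator G x (a \<otimes> b) = commutator G x a \<otimes> (a \<otimes> commutator G x b \<otimes> inv a)"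
  using assms by (simp add: commutator_def m_assoc inv_mult_group)

lemma commutator_mult_left:
  assumes "x \<in> carrier G" "y \<in> carrier G" "g \<in> carrier G"
  shows "commutator G (x \<otimes> y) g = x \<otimes> commutator G y g \<otimes> inv x \<otimes> commutator G x g"
  using assms by (simp add: commutator_def m_assoc inv_mult_group)

text \<open>The commutators \<open>[x, g]\<close> are central modulo \<open>N\<close>, so conjugating them has no effect there and
\<open>[x, a b] = [x, a] (a [x, b] a\<^sup>-\<^sup>1)\<close> becomes multiplicative in the second argument.\<close>

lemma commutator_map_hom:
  assumes "N \<lhd> G" and x: "x \<in> carrier G"
    and comm: "\<And>g a. g \<in> carrier G \<Longrightarrow> a \<in> carrier G \<Longrightarrow> commutator G (commutator G x g) a \<in> N"
  shows "group_hom G (G Mod N) (\<lambda>g. N #> commutator G x g)"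
proof -
  interpret normal N G by fact
  interpret q: group_hom G "G Mod N" "\<lambda>x. N #> x" by (rule quotient_map_hom)
  have "N #> commutator G x (a \<otimes> b) = (N #> commutator G x a) \<otimes>\<^bsub>G Mod N\<^esub> (N #> commutator G x b)"
    if ab: "a \<in> carrier G" "b \<in> carrier G" for a b
  proof -
    define A B where "A = N #> a" and "B = N #> commutator G x b"
    have AB: "A \<in> carrier (G Mod N)" "B \<in> carrier (G Mod N)"
      unfolding A_def B_def by (intro q.hom_closed commutator_closed x ab)+
    have "B \<otimes>\<^bsub>G Mod N\<^esub> A = A \<otimes>\<^bsub>G Mod N\<^esub> B"
      unfolding A_def B_def using comm[OF ab(2,1)] x ab
      by (subst commute_mod_iff) auto
    then have "A \<otimes>\<^bsub>G Mod N\<^esub> B \<otimes>\<^bsub>G Mod N\<^esub> inv\<^bsub>G Mod N\<^esub> A = B"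
      using AB by (metis q.H.inv_closed q.H.m_assoc q.H.r_inv q.H.r_one)
    moreover have "N #> (a \<otimes> commutator G x b \<otimes> inv a) = A \<otimes>\<^bsub>G Mod N\<^esub> B \<otimes>\<^bsub>G Mod N\<^esub> inv\<^bsub>G Mod N\<^esub> A"
      unfolding A_def B_def using x ab
        q.hom_mult[of "a \<otimes> commutator G x b" "inv a"] q.hom_mult[of a "commutator G x b"]
        q.hom_inv[of a] by (simp del: mult_FactGroup)
    ultimately show ?thesis
      using x ab q.hom_mult[of "commutator G x a" "a \<otimes> commutator G x b \<otimes> inv a"]
      unfolding commutator_mult_right[OF x ab] B_def[symmetric] by (simp del: mult_FactGroup)
  qed
  moreover have "N #> commutator G x g \<in> carrier (G Mod N)" if "g \<in> carrier G" for g
    using x that by (intro q.hom_closed commutator_closed)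
  ultimately show ?thesis
    using group_axioms q.H.group_axioms
    by (auto simp: group_hom_def group_hom_axioms_def hom_def simp del: mult_FactGroup)
qed

lemma commutator_lower_p_series_map_hom:
  assumes x: "x \<in> lower_p_series p G i"
  shows "group_hom G (G Mod lower_p_series p G (Suc (Suc i)))
    (\<lambda>g. lower_p_series p G (Suc (Suc i)) #> commutator G x g)"
  by (intro commutator_map_hom normal_lower_p_series lower_p_series_carrier[OF x]
      commutator_in_lower_p_series_Suc x)

text \<open>For \<open>x\<close> in the term \<open>i\<close>, the map \<open>g \<mapsto> [x, g]\<close> is a homomorphism from \<open>G\<close> into the elementary abelian
factor between the terms \<open>i + 1\<close> and \<open>i + 2\<close>. Such a homomorphism kills commutators and \<open>p\<close>-th powers,
which generate the term \<open>1\<close>.\<close>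

lemma commutator_lower_p_series_in:
  assumes x: "x \<in> lower_p_series p G i" and h: "h \<in> lower_p_series p G (Suc 0)"
  shows "commutator G x h \<in> lower_p_series p G (Suc (Suc i))"
proof -
  define N where "N = lower_p_series p G (Suc (Suc i))"
  interpret normal N G unfolding N_def by (rule normal_lower_p_series)
  interpret q: group_hom G "G Mod N" "\<lambda>x. N #> x" by (rule quotient_map_hom)
  \<comment> \<open>the homomorphism into the elementary abelian factor, viewed as a map to \<open>G/N\<close>\<close>
  interpret f: group_hom G "G Mod N" "\<lambda>g. N #> commutator G x g"
    unfolding N_def by (rule commutator_lower_p_series_map_hom[OF x])
  have xc: "x \<in> carrier G" by (rule lower_p_series_carrier[OF x])
  have "lower_p_series p G (Suc 0) \<subseteq> kernel G (G Mod N) (\<lambda>g. N #> commutator G x g)"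
  proof (rule lower_p_series_Suc_least[OF f.subgroup_kernel])
    fix a assume "a \<in> lower_p_series p G 0"
    then have a: "a \<in> carrier G" by simp
    have xa: "commutator G x a \<in> lower_p_series p G (Suc i)"
      by (rule commutator_in_lower_p_series_Suc[OF x a])
    have "N #> commutator G x (a [^] p) = (N #> commutator G x a) [^]\<^bsub>G Mod N\<^esub> p"
      by (rule f.hom_nat_pow[OF a])
    also have "\<dots> = N #> (commutator G x a [^] p)"
      using q.hom_nat_pow[of "commutator G x a" p] a xc by (simp only: commutator_closed)
    also have "\<dots> = \<one>\<^bsub>G Mod N\<^esub>"
      using pow_in_lower_p_series_Suc[OF xa] a xc
      by (subst quotient_map_eq_one_iff) (auto simp: N_def simp del: lower_p_series.simps)
    finally show "a [^] p \<in> kernel G (G Mod N) (\<lambda>g. N #> commutator G x g)"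
      using a by (simp add: kernel_def)
    fix b assume b: "b \<in> carrier G"
    have xb: "commutator G x b \<in> lower_p_series p G (Suc i)"
      by (rule commutator_in_lower_p_series_Suc[OF x b])
    have "commutator G (commutator G x a) (commutator G x b) \<in> N"
      unfolding N_def by (rule commutator_in_lower_p_series_Suc[OF xa]) (use xc b in simp)
    then have "commutator (G Mod N) (N #> commutator G x a) (N #> commutator G x b) = \<one>\<^bsub>G Mod N\<^esub>"
      using a b xc commute_mod_iff[of "commutator G x a" "commutator G x b"]
      by (subst q.H.commutator_eq_one_iff) (auto simp del: mult_FactGroup intro: q.hom_closed)
    then have "N #> commutator G x (commutator G a b) = \<one>\<^bsub>G Mod N\<^esub>"
      using f.hom_commutator[OF a b] by simp
    then show "commutator G a b \<in> kernel G (G Mod N) (\<lambda>g. N #> commutator G x g)"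
      using a b by (simp add: kernel_def)
  qed
  then have "N #> commutator G x h = \<one>\<^bsub>G Mod N\<^esub>"
    using h by (auto simp: kernel_def)
  then show ?thesis
    using xc h lower_p_series_carrier[OF h]
    by (simp only: quotient_map_eq_one_iff commutator_closed N_def[symmetric])
qed

text \<open>Every factor of the series is determined by \<open>G\<close> modulo the term \<open>1\<close>: if \<open>x\<close> changes by an element of the
next term and \<open>g\<close> by an element of the term \<open>1\<close>, then \<open>[x, g]\<close> and \<open>x\<^sup>p\<close> do not change modulo the term
\<open>i + 2\<close>. Hence an endomorphism that is trivial on the top factor is trivial on all of them.\<close>

lemma endomorphism_lower_p_series:
  assumes u: "u \<in> hom G G"
    and triv: "\<And>x. x \<in> carrier G \<Longrightarrow> inv x \<otimes> u x \<in> lower_p_series p G (Suc 0)"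
    and x: "x \<in> lower_p_series p G i"
  shows "inv x \<otimes> u x \<in> lower_p_series p G (Suc i)"
  using x
proof (induction i arbitrary: x)
  case 0
  then show ?case using triv by simp
next
  case (Suc i)
  interpret u: group_hom G G u
    using u by (simp add: group_hom_def group_hom_axioms_def group_axioms)
  define N where "N = lower_p_series p G (Suc (Suc i))"
  interpret normal N G unfolding N_def by (rule normal_lower_p_series)
  interpret q: group_hom G "G Mod N" "\<lambda>x. N #> x" by (rule quotient_map_hom)
  have qu: "group_hom G (G Mod N) (\<lambda>x. N #> u x)"
    using Group.hom_compose[OF u q.homh] group_axioms q.H.group_axioms
    by (simp add: group_hom_def group_hom_axioms_def comp_def)
  have "lower_p_series p G (Suc i) \<subseteq> {x \<in> carrier G. N #> x = N #> u x}"
  proof (rule lower_p_series_Suc_least[OF subgroup_equalizer[OF q.group_hom_axioms qu subgroup_self]])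
    fix x assume x: "x \<in> lower_p_series p G i"
    have xc: "x \<in> carrier G" by (rule lower_p_series_carrier[OF x])
    define y where "y = inv x \<otimes> u x"
    have y: "y \<in> lower_p_series p G (Suc i)" unfolding y_def by (rule Suc.IH[OF x])
    have yc: "y \<in> carrier G" by (rule lower_p_series_carrier[OF y])
    have ux: "u x = x \<otimes> y" using xc by (simp add: y_def)
    have comm_y: "commutator G y g \<in> N" if "g \<in> carrier G" for g
      unfolding N_def by (rule commutator_in_lower_p_series_Suc[OF y that])
    have "N #> u (x [^] p) = N #> ((x \<otimes> y) [^] p)"
      using xc by (simp add: u.hom_nat_pow ux)
    also have "\<dots> = ((N #> x) \<otimes>\<^bsub>G Mod N\<^esub> (N #> y)) [^]\<^bsub>G Mod N\<^esub> p"
      using xc yc q.hom_nat_pow[of "x \<otimes> y" p] q.hom_mult[of x y] by (simp del: mult_FactGroup)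
    also have "\<dots> = (N #> x) [^]\<^bsub>G Mod N\<^esub> p \<otimes>\<^bsub>G Mod N\<^esub> (N #> y) [^]\<^bsub>G Mod N\<^esub> p"
      using commute_mod_iff[OF yc xc] comm_y[OF xc] xc yc
      by (intro q.H.pow_mult_distrib q.hom_closed) auto
    also have "(N #> y) [^]\<^bsub>G Mod N\<^esub> p = \<one>\<^bsub>G Mod N\<^esub>"
      using pow_in_lower_p_series_Suc[OF y] quotient_map_eq_one_iff[of "y [^] p"]
        q.hom_nat_pow[OF yc, of p] yc by (simp add: N_def[symmetric])
    also have "(N #> x) [^]\<^bsub>G Mod N\<^esub> p \<otimes>\<^bsub>G Mod N\<^esub> \<one>\<^bsub>G Mod N\<^esub> = N #> (x [^] p)"
      using xc by (simp only: q.hom_nat_pow q.H.r_one q.H.nat_pow_closed q.hom_closed)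
    finally show "x [^] p \<in> {x \<in> carrier G. N #> x = N #> u x}"
      using xc by simp
    fix g assume g: "g \<in> carrier G"
    define h where "h = inv g \<otimes> u g"
    have h: "h \<in> lower_p_series p G (Suc 0)" unfolding h_def by (rule triv[OF g])
    have hc: "h \<in> carrier G" by (rule lower_p_series_carrier[OF h])
    have ug: "u g = g \<otimes> h" using g by (simp add: h_def)
    interpret f: group_hom G "G Mod N" "\<lambda>g. N #> commutator G x g"
      unfolding N_def by (rule commutator_lower_p_series_map_hom[OF x])
    have fh: "N #> commutator G x h = \<one>\<^bsub>G Mod N\<^esub>"
      using commutator_lower_p_series_in[OF x h] quotient_map_eq_one_iff[of "commutator G x h"] xc hc
      by (simp only: commutator_closed N_def)
    have "u (commutator G x g) = commutator G (x \<otimes> y) (u g)"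
      using u.hom_commutator[OF xc g] ux by simp
    also have "\<dots> = x \<otimes> commutator G y (u g) \<otimes> inv x \<otimes> commutator G x (u g)"
      using xc yc g by (intro commutator_mult_left) auto
    finally have "N #> u (commutator G x g)
        = (N #> (x \<otimes> commutator G y (u g) \<otimes> inv x)) \<otimes>\<^bsub>G Mod N\<^esub> (N #> commutator G x (u g))"
      using xc yc g q.hom_mult[of "x \<otimes> commutator G y (u g) \<otimes> inv x" "commutator G x (u g)"]
      by (simp del: mult_FactGroup)
    also have "x \<otimes> commutator G y (u g) \<otimes> inv x \<in> N"
      using comm_y[of "u g"] xc g by (intro inv_op_closed2) auto
    then have "N #> (x \<otimes> commutator G y (u g) \<otimes> inv x) = \<one>\<^bsub>G Mod N\<^esub>"
      using quotient_map_eq_one_iff[of "x \<otimes> commutator G y (u g) \<otimes> inv x"] xc yc g by simp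
    also have "N #> commutator G x (u g) = (N #> commutator G x g) \<otimes>\<^bsub>G Mod N\<^esub> (N #> commutator G x h)"
      unfolding ug by (rule f.hom_mult[OF g hc])
    also have "\<dots> = N #> commutator G x g"
      unfolding fh using g by (intro q.H.r_one f.hom_closed)
    also have "\<one>\<^bsub>G Mod N\<^esub> \<otimes>\<^bsub>G Mod N\<^esub> (N #> commutator G x g) = N #> commutator G x g"
      using g by (intro q.H.l_one f.hom_closed)
    finally show "commutator G x g \<in> {x \<in> carrier G. N #> x = N #> u x}"
      using xc g by simp
  qed
  then have "N #> x = N #> u x" using Suc.prems by blast
  then show ?case
    unfolding N_def[symmetric] using quotient_map_eq_iff Suc.prems by simp
qed

lemma hom_funpow: "u \<in> hom G G \<Longrightarrow> u ^^ n \<in> hom G G"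
proof (induction n)
  case (Suc n)
  then show ?case using Group.hom_compose[of "u ^^ n" G G u G] by (simp add: comp_def)
qed (simp add: hom_def)

text \<open>With \<open>u x = x y\<close> and \<open>y \<in> M\<close>, every further application of \<open>u\<close> contributes another factor that is
congruent to \<open>y\<close> modulo \<open>N\<close>, since \<open>u\<close> fixes \<open>M\<close> modulo \<open>N\<close>. So \<open>u\<^sup>n x\<close> is congruent to \<open>x y\<^sup>n\<close>, hence
to \<open>x\<close>.\<close>

lemma endomorphism_pow_step:
  assumes u: "u \<in> hom G G" and N: "N \<lhd> G" and M: "subgroup M G" "N \<subseteq> M"
    and mod_M: "\<And>x. x \<in> carrier G \<Longrightarrow> inv x \<otimes> u x \<in> M"
    and M_mod_N: "\<And>y. y \<in> M \<Longrightarrow> inv y \<otimes> u y \<in> N"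
    and pow: "\<And>y. y \<in> M \<Longrightarrow> y [^] n \<in> N"
    and x: "x \<in> carrier G"
  shows "inv x \<otimes> (u ^^ n) x \<in> N"
proof -
  interpret normal N G by fact
  interpret M: subgroup M G by fact
  interpret q: group_hom G "G Mod N" "\<lambda>x. N #> x" by (rule quotient_map_hom)
  have uc: "(u ^^ k) x \<in> carrier G" if "x \<in> carrier G" for x k
    using hom_funpow[OF u, of k] that by (auto simp: hom_def)
  have fix_M: "N #> (u ^^ k) y = N #> y" if "y \<in> M" for y k
    using that
  proof (induction k arbitrary: y)
    case (Suc k)
    have yc: "y \<in> carrier G" "u y \<in> carrier G" using Suc.prems uc[of y 1] by auto
    have "y \<otimes> (inv y \<otimes> u y) \<in> M"
      using Suc.prems M_mod_N M(2) by blast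
    then have "u y \<in> M" using yc by simp
    then have "N #> (u ^^ Suc k) y = N #> u y"
      using Suc.IH by (simp add: funpow_swap1)
    also have "\<dots> = N #> y"
      using quotient_map_eq_iff[OF yc] M_mod_N[OF Suc.prems] by simp
    finally show ?case .
  qed simp
  define y where "y = inv x \<otimes> u x"
  have y: "y \<in> M" using mod_M[OF x] by (simp add: y_def)
  have yc: "y \<in> carrier G" using y by auto
  have ux: "u x = x \<otimes> y" using x uc[OF x, of 1] by (simp add: y_def)
  have "N #> (u ^^ k) x = N #> (x \<otimes> y [^] k)" for k
  proof (induction k)
    case (Suc k)
    have "(u ^^ Suc k) x = (u ^^ k) x \<otimes> (u ^^ k) y"
      using hom_mult[OF hom_funpow[OF u, of k] x yc] by (simp add: funpow_swap1 ux)
    then have "N #> (u ^^ Suc k) x = (N #> (u ^^ k) x) \<otimes>\<^bsub>G Mod N\<^esub> (N #> (u ^^ k) y)"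
      using x yc uc by (simp only: q.hom_mult)
    also have "\<dots> = N #> (x \<otimes> y [^] k \<otimes> y)"
      unfolding Suc.IH fix_M[OF y] using x yc by (intro q.hom_mult[symmetric]) simp_all
    finally show ?case using x yc by (simp add: m_assoc)
  qed (use x in simp)
  from this[of n] have "N #> (u ^^ n) x = (N #> x) \<otimes>\<^bsub>G Mod N\<^esub> (N #> (y [^] n))"
    using x yc by (simp only: q.hom_mult nat_pow_closed)
  also have "N #> (y [^] n) = \<one>\<^bsub>G Mod N\<^esub>"
    using pow[OF y] quotient_map_eq_one_iff[of "y [^] n"] yc by blast
  also have "(N #> x) \<otimes>\<^bsub>G Mod N\<^esub> \<one>\<^bsub>G Mod N\<^esub> = N #> x"
    using x by (intro q.H.r_one q.hom_closed)
  finally show ?thesis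
    using quotient_map_eq_iff[OF x uc[OF x, of n]] by simp
qed

theorem endomorphism_pow_trivial_mod_lower_p_series:
  assumes u: "u \<in> hom G G"
    and triv: "\<And>x. x \<in> carrier G \<Longrightarrow> inv x \<otimes> u x \<in> lower_p_series p G (Suc 0)"
    and "x \<in> carrier G"
  shows "inv x \<otimes> (u ^^ (p ^ i)) x \<in> lower_p_series p G (Suc i)"
  using assms(3)
proof (induction i arbitrary: x)
  case 0
  then show ?case using triv by simp
next
  case (Suc i)
  define v where "v = u ^^ (p ^ i)"
  have v: "v \<in> hom G G" unfolding v_def by (rule hom_funpow[OF u])
  have mod: "inv x \<otimes> v x \<in> lower_p_series p G (Suc i)" if "x \<in> carrier G" for x
    unfolding v_def by (rule Suc.IH[OF that])
  then have mod0: "inv x \<otimes> v x \<in> lower_p_series p G (Suc 0)" if "x \<in> carrier G" for x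
    using that lower_p_series_antimono[of "Suc 0" "Suc i"] by blast
  have "inv x \<otimes> (v ^^ p) x \<in> lower_p_series p G (Suc (Suc i))"
    by (rule endomorphism_pow_step[OF v normal_lower_p_series subgroup_lower_p_series
          lower_p_series_Suc_subset mod endomorphism_lower_p_series[OF v mod0]
          pow_in_lower_p_series_Suc Suc.prems])
  moreover have "v ^^ p = u ^^ (p ^ Suc i)"
    by (simp add: v_def funpow_mult mult.commute)
  ultimately show ?case by simp
qed

end

section \<open>Unipotent maps of elementary abelian groups\<close>

context comm_group
begin

lemma hom_difference:
  assumes "u \<in> hom G G"
  shows "(\<lambda>x. inv x \<otimes> u x) \<in> hom G G"
  using assms by (auto simp: hom_def Pi_iff m_ac inv_mult)

text \<open>This is the binomial expansion of \<open>u\<^sup>n = (1 + f)\<^sup>n\<close> in the endomorphism ring of an abelian group, where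
\<open>f = u - 1\<close>.\<close>

lemma funpow_binomial:
  assumes u: "u \<in> hom G G" and x: "x \<in> carrier G"
  shows "(u ^^ n) x = (\<Otimes>k\<in>{..n}. ((\<lambda>y. inv y \<otimes> u y) ^^ k) x [^] (n choose k))"
proof -
  define f where "f = (\<lambda>y. inv y \<otimes> u y)"
  interpret u: group_hom G G u
    using u by (simp add: group_hom_def group_hom_axioms_def group_axioms)
  have f: "f \<in> hom G G" unfolding f_def by (rule hom_difference[OF u])
  have fc: "(f ^^ k) x \<in> carrier G" for k
    using hom_funpow[OF f, of k] x by (auto simp: hom_def)
  have uf: "u ((f ^^ k) x) = (f ^^ k) x \<otimes> (f ^^ Suc k) x" for k
    using fc[of k] by (simp add: f_def)
  have u_prod: "u (\<Otimes>k\<in>{..m}. (f ^^ k) x [^] c k)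
      = (\<Otimes>k\<in>{..m}. (f ^^ k) x [^] c k) \<otimes> (\<Otimes>k\<in>{..m}. (f ^^ Suc k) x [^] c k)"
    for m and c :: "nat \<Rightarrow> nat"
  proof (induction m)
    case 0
    show ?case using fc[of 0] fc[of 1] uf[of 0] 
      by (simp add: u.hom_nat_pow nat_pow_distrib)
  next
    case (Suc m)
    then show ?case using fc fc[of "Suc _"] uf[of "Suc m"]
      by (simp add: u.hom_nat_pow nat_pow_distrib m_ac Pi_iff del: funpow.simps)
  qed
  have "(u ^^ n) x = (\<Otimes>k\<in>{..n}. (f ^^ k) x [^] (n choose k))"
  proof (induction n)
    case 0
    show ?case using x by simp
  next
    case (Suc n)
    have "(u ^^ Suc n) x = u ((u ^^ n) x)" by simp
    also have "\<dots> = (\<Otimes>k\<in>{..n}. (f ^^ k) x [^] (n choose k))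
        \<otimes> (\<Otimes>k\<in>{..n}. (f ^^ Suc k) x [^] (n choose k))"
      unfolding Suc.IH by (rule u_prod)
    also have "(\<Otimes>k\<in>{..n}. (f ^^ k) x [^] (n choose k))
        = (\<Otimes>k\<in>{..Suc n}. (f ^^ k) x [^] (n choose k))"
      using fc by (simp add: Pi_iff binomial_eq_0 del: funpow.simps)
    also have "\<dots> = (\<Otimes>k\<in>{..n}. (f ^^ Suc k) x [^] (n choose Suc k)) \<otimes> x"
      using fc x finprod_Suc2[of "\<lambda>k. (f ^^ k) x [^] (n choose k)" n]
      by (simp add: Pi_iff del: funpow.simps(2) finprod_Suc)
    also have "\<dots> \<otimes> (\<Otimes>k\<in>{..n}. (f ^^ Suc k) x [^] (n choose k))
        = (\<Otimes>k\<in>{..n}. (f ^^ Suc k) x [^] (n choose k)) \<otimes>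
          (\<Otimes>k\<in>{..n}. (f ^^ Suc k) x [^] (n choose Suc k)) \<otimes> x"
      using fc x by (simp add: Pi_iff m_ac del: funpow.simps(2))
    also have "\<dots>
        = (\<Otimes>k\<in>{..n}. (f ^^ Suc k) x [^] (n choose k) \<otimes> (f ^^ Suc k) x [^] (n choose Suc k)) \<otimes> x"
      using fc by (simp add: Pi_iff del: funpow.simps(2))
    also have "\<dots> = (\<Otimes>k\<in>{..n}. (f ^^ Suc k) x [^] (Suc n choose Suc k)) \<otimes> x"
      using fc by (simp add: nat_pow_mult del: funpow.simps)
    also have "\<dots> = (\<Otimes>k\<in>{..Suc n}. (f ^^ k) x [^] (Suc n choose k))"
      using fc x finprod_Suc2[of "\<lambda>k. (f ^^ k) x [^] (Suc n choose k)" n]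
      by (simp add: Pi_iff del: funpow.simps(2) finprod_Suc binomial_Suc_Suc)
    finally show ?case .
  qed
  then show ?thesis by (simp add: f_def)
qed

text \<open>In an elementary abelian group the inner binomial coefficients act as zero, so
\<open>(1 + f)\<^sup>p = 1 + f\<^sup>p\<close>.\<close>

lemma funpow_prime:
  assumes u: "u \<in> hom G G" and x: "x \<in> carrier G" and p: "Factorial_Ring.prime p"
    and exp: "\<And>y. y \<in> carrier G \<Longrightarrow> y [^] p = \<one>"
  shows "(u ^^ p) x = x \<otimes> ((\<lambda>y. inv y \<otimes> u y) ^^ p) x"
proof -
  define f where "f = (\<lambda>y. inv y \<otimes> u y)"
  have f: "f \<in> hom G G" unfolding f_def by (rule hom_difference[OF u])
  have fc: "(f ^^ k) x \<in> carrier G" for k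
    using hom_funpow[OF f, of k] x by (auto simp: hom_def)
  have p0: "0 < p" using p by (rule prime_gt_0_nat)
  have triv: "(f ^^ k) x [^] (p choose k) = \<one>" if "k \<in> {Suc 0..<p}" for k
  proof -
    have "p dvd (p choose k)" using that p p0 by (intro dvd_choose_prime) auto
    then obtain m where "p choose k = p * m" by (elim dvdE)
    then show ?thesis using exp[OF fc[of k]] fc[of k] by (metis nat_pow_pow nat_pow_one)
  qed
  have "(u ^^ p) x = (\<Otimes>k\<in>{..p}. (f ^^ k) x [^] (p choose k))"
    unfolding f_def by (rule funpow_binomial[OF u x])
  also have "{..p} = insert 0 (insert p {Suc 0..<p})"
    using p0 by auto
  also have "(\<Otimes>k\<in>\<dots>. (f ^^ k) x [^] (p choose k))
      = x \<otimes> ((f ^^ p) x \<otimes> (\<Otimes>k\<in>{Suc 0..<p}. (f ^^ k) x [^] (p choose k)))"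
    using p0 x fc by (subst finprod_insert; (simp add: Pi_iff)?)+
  also have "(\<Otimes>k\<in>{Suc 0..<p}. (f ^^ k) x [^] (p choose k)) = \<one>"
    by (rule finprod_one_eqI) (rule triv)
  finally show ?thesis using fc x by (simp add: f_def)
qed

lemma funpow_prime_power:
  assumes u: "u \<in> hom G G" and x: "x \<in> carrier G" and p: "Factorial_Ring.prime p"
    and exp: "\<And>y. y \<in> carrier G \<Longrightarrow> y [^] p = \<one>"
  shows "(u ^^ (p ^ m)) x = x \<otimes> ((\<lambda>y. inv y \<otimes> u y) ^^ (p ^ m)) x"
  using x
proof (induction m arbitrary: x)
  case 0
  then show ?case using hom_in_carrier[OF u, of x] by simp
next
  case (Suc m)
  define f where "f = (\<lambda>y. inv y \<otimes> u y)"
  define v where "v = u ^^ (p ^ m)"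
  have f: "f \<in> hom G G" unfolding f_def by (rule hom_difference[OF u])
  have fc: "(f ^^ k) y \<in> carrier G" if "y \<in> carrier G" for k y
    using hom_funpow[OF f, of k] that by (auto simp: hom_def)
  have v: "v \<in> hom G G" unfolding v_def by (rule hom_funpow[OF u])
  have vf: "inv y \<otimes> v y = (f ^^ (p ^ m)) y" if "y \<in> carrier G" for y
    using Suc.IH[OF that] fc[OF that] that by (simp add: v_def f_def)
  have "((\<lambda>y. inv y \<otimes> v y) ^^ k) x = ((f ^^ (p ^ m)) ^^ k) x" for k
  proof (induction k)
    case (Suc k)
    have "((f ^^ (p ^ m)) ^^ k) x \<in> carrier G"
      using fc[OF Suc.prems] \<open>x \<in> carrier G\<close> by (simp add: funpow_mult fc)
    then show ?case using Suc.IH vf by simp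
  qed simp
  then have "(v ^^ p) x = x \<otimes> ((f ^^ (p ^ m)) ^^ p) x"
    using funpow_prime[OF v Suc.prems p exp] by simp
  then show ?case by (simp add: v_def f_def funpow_mult mult.commute)
qed

end

text \<open>The iterated images of a nilpotent endomorphism decrease strictly until they are trivial, and each
strict step divides the order by at least \<open>p\<close>.\<close>

lemma (in group) nilpotent_endomorphism_bound:
  assumes f: "f \<in> hom G G" and fin: "finite (carrier G)" and p: "Factorial_Ring.prime p"
    and ord: "order G = p ^ d"
    and nil: "\<And>x. x \<in> carrier G \<Longrightarrow> (f ^^ k) x = \<one>"
    and x: "x \<in> carrier G"
  shows "(f ^^ d) x = \<one>"
proof -
  define W where "W i = (f ^^ i) ` carrier G" for i
  have W_sub: "subgroup (W i) G" for i
  proof -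
    interpret fi: group_hom G G "f ^^ i"
      using hom_funpow[OF f, of i] by (simp add: group_hom_def group_hom_axioms_def group_axioms)
    show ?thesis unfolding W_def by (rule fi.img_is_subgroup)
  qed
  have W_Suc: "W (Suc i) = f ` W i" for i
    by (auto simp: W_def image_comp)
  have W_mono: "W (Suc i) \<subseteq> W i" for i
    using hom_in_carrier[OF f] by (auto simp: W_def funpow_swap1)
  have fin_W: "finite (W i)" for i using fin by (simp add: W_def)
  \<comment> \<open>once the images become stationary they stay so, and nilpotency makes them trivial\<close>
  have W_nil: "W i = {\<one>}" if "W (Suc i) = W i" for i
  proof -
    have "(f ^^ j) ` W i = W i" for j
    proof (induction j)
      case (Suc j)
      have "(f ^^ Suc j) ` W i = f ` (f ^^ j) ` W i" by (simp add: image_comp)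
      also have "\<dots> = W i" using Suc that W_Suc by simp
      finally show ?case .
    qed simp
    then have "W i = (f ^^ k) ` W i" by simp
    also have "\<dots> \<subseteq> {\<one>}"
      using nil[OF subgroup.mem_carrier[OF W_sub]] by (simp add: image_subset_iff)
    finally show ?thesis using subgroup.one_closed[OF W_sub[of i]] by auto
  qed
  have W_card: "\<exists>a. card (W i) = p ^ a" for i
  proof -
    have "card (W i) dvd p ^ d"
      unfolding ord[symmetric] lagrange[OF W_sub[of i], symmetric] by simp
    then show ?thesis using divides_primepow_nat[OF p, of "card (W i)" d] by auto
  qed
  have "W i = {\<one>} \<or> card (W i) * p ^ i \<le> p ^ d" for i
  proof (induction i)
    case 0
    show ?case using ord by (simp add: W_def order_def)
  next
    case (Suc i)
    show ?case
    proof (cases "W (Suc i) = W i")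
      case True
      then show ?thesis using W_nil by simp
    next
      case False
      then have lt: "card (W (Suc i)) < card (W i)"
        using W_mono fin_W by (intro psubset_card_mono) auto
      obtain a b where ab: "card (W i) = p ^ a" "card (W (Suc i)) = p ^ b"
        using W_card by metis
      have "b < a" using lt ab prime_gt_1_nat[OF p] by simp
      then have "card (W (Suc i)) * p \<le> card (W i)"
        using ab prime_gt_0_nat[OF p] power_increasing[of "Suc b" a p] by (simp add: mult.commute)
      then have "card (W (Suc i)) * p ^ Suc i \<le> card (W i) * p ^ i"
        using mult_le_mono1[of _ _ "p ^ i"] by (simp add: mult.assoc)
      moreover have "W (Suc i) = {\<one>}" if "W i = {\<one>}"
        using W_mono[of i] that subgroup.one_closed[OF W_sub[of "Suc i"]] by auto
      ultimately show ?thesis using Suc.IH le_trans by blast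
    qed
  qed
  from this[of d] have "W d = {\<one>} \<or> card (W d) \<le> 1"
    using prime_gt_0_nat[OF p] by (simp add: mult_le_cancel2)
  then have "W d \<subseteq> {\<one>}"
    using subgroup.one_closed[OF W_sub[of d]] card_le_Suc0_iff_eq[OF fin_W[of d]] by auto
  then show ?thesis using x by (auto simp: W_def)
qed

text \<open>Adjoining a generator multiplies an abelian subgroup by a cyclic group of order dividing \<open>p\<close>.\<close>

lemma (in comm_group) card_generate_le_prime_exponent:
  assumes "finite S" "S \<subseteq> carrier G" and p: "0 < p"
    and exp: "\<And>y. y \<in> carrier G \<Longrightarrow> y [^] (p::nat) = \<one>"
  shows "finite (generate G S) \<and> card (generate G S) \<le> p ^ card S"
  using assms(1,2)
proof (induction S)
  case empty
  show ?case by (simp add: generate_empty)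
next
  case (insert a S)
  have a: "a \<in> carrier G" and S: "S \<subseteq> carrier G" using insert by auto
  have "ord a dvd p" using exp[OF a] pow_eq_id[OF a] by blast
  then have ord: "0 < ord a" "ord a \<le> p" using p by (auto intro: dvd_imp_le gr0I)
  have card_a: "card (generate G {a}) = ord a" by (rule generate_pow_card[OF a, symmetric])
  then have fin_a: "finite (generate G {a})" using ord(1) card.infinite by force
  have sub: "subgroup (generate G {a} <#> generate G S) G"
    using a S by (intro mult_subgroups generate_is_subgroup) auto
  have one: "\<one> \<in> generate G {a}" "\<one> \<in> generate G S" by (auto intro: generate.one)
  have incl: "insert a S \<subseteq> generate G {a} <#> generate G S"
  proof
    fix y assume "y \<in> insert a S"
    then have "y \<in> generate G {a} \<and> y \<otimes> \<one> = y \<or> y \<in> generate G S \<and> \<one> \<otimes> y = y"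
      using a S by (auto intro: generate.incl)
    then show "y \<in> generate G {a} <#> generate G S"
      unfolding set_mult_def using one by blast
  qed
  then have sub': "generate G (insert a S) \<subseteq> (\<lambda>(x, y). x \<otimes> y) ` (generate G {a} \<times> generate G S)"
    using generate_subgroup_incl[OF incl sub] unfolding set_mult_def by auto
  have fin: "finite (generate G {a} \<times> generate G S)"
    using fin_a insert S by simp
  have "card (generate G (insert a S)) \<le> card (generate G {a} \<times> generate G S)"
    using sub' fin by (meson card_image_le card_mono finite_imageI le_trans)
  also have "\<dots> \<le> p * p ^ card S"
    using insert S ord card_a by (auto simp: card_cartesian_product intro!: mult_mono)
  finally show ?case
    using insert sub' fin by (auto intro: finite_subset)
qed

lemma le_power_pred:
  assumes "2 \<le> (p::nat)"
  shows "d \<le> p ^ (d - 1)"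
proof (cases d)
  case (Suc e)
  have "Suc e \<le> 2 ^ e" by (simp add: Suc_le_eq less_exp)
  also have "\<dots> \<le> p ^ e" using assms by (simp add: power_mono)
  finally show ?thesis using Suc by simp
qed simp

text \<open>Write \<open>u = 1 + f\<close>. From \<open>1 = u\<^sup>q = 1 + f\<^sup>q\<close> for \<open>q = p\<^sup>k\<close> it follows that \<open>f\<close> is nilpotent; the order of the
group then gives \<open>f\<^sup>d = 0\<close>, and \<open>d \<le> p\<^sup>d\<^sup>-\<^sup>1\<close> makes the same identity, read backwards, yield the claim.\<close>

lemma (in comm_group) unipotent_pow_eq_id:
  assumes fin: "finite (carrier G)" and p: "Factorial_Ring.prime p"
    and exp: "\<And>y. y \<in> carrier G \<Longrightarrow> y [^] p = \<one>"
    and ord: "order G = p ^ m" "order G \<le> p ^ d"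
    and u: "u \<in> hom G G" and pow: "\<And>x. x \<in> carrier G \<Longrightarrow> (u ^^ (p ^ k)) x = x"
    and x: "x \<in> carrier G"
  shows "(u ^^ (p ^ (d - 1))) x = x"
proof -
  define f where "f = (\<lambda>y. inv y \<otimes> u y)"
  have f: "f \<in> hom G G" unfolding f_def by (rule hom_difference[OF u])
  have fc: "(f ^^ k) y \<in> carrier G" if "y \<in> carrier G" for k y
    using hom_funpow[OF f, of k] that by (auto simp: hom_def)
  have u_eq: "(u ^^ (p ^ j)) y = y \<otimes> (f ^^ (p ^ j)) y" if "y \<in> carrier G" for j y
    unfolding f_def by (rule funpow_prime_power[OF u that p exp])
  have nil: "(f ^^ (p ^ k)) y = \<one>" if "y \<in> carrier G" for y
    using u_eq[OF that, of k] pow[OF that] fc[OF that, of "p ^ k"] that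
    by (metis l_cancel_one')
  have nil_m: "(f ^^ m) y = \<one>" if "y \<in> carrier G" for y
    by (rule nilpotent_endomorphism_bound[OF f fin p ord(1) nil that])
  have "m \<le> d" using ord prime_gt_1_nat[OF p] by simp
  also have "d \<le> p ^ (d - 1)" by (rule le_power_pred[OF prime_ge_2_nat[OF p]])
  finally obtain j where "p ^ (d - 1) = m + j" using le_Suc_ex by blast
  then have "(f ^^ (p ^ (d - 1))) x = (f ^^ m) ((f ^^ j) x)" by (simp add: funpow_add)
  also have "\<dots> = \<one>" by (rule nil_m[OF fc[OF x]])
  finally show ?thesis using u_eq[OF x, of "d - 1"] x by simp
qed

section \<open>Automorphisms of finite p-groups\<close>

context group
begin

lemma hom_lower_p_series_1:
  assumes u: "u \<in> hom G G" and x: "x \<in> lower_p_series p G (Suc 0)"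
  shows "u x \<in> lower_p_series p G (Suc 0)"
proof -
  interpret u: group_hom G G u
    using u by (simp add: group_hom_def group_hom_axioms_def group_axioms)
  interpret L: subgroup "lower_p_series p G (Suc 0)" G by (rule subgroup_lower_p_series)
  have "lower_p_series p G (Suc 0) \<subseteq> {x \<in> carrier G. u x \<in> lower_p_series p G (Suc 0)}"
  proof (rule lower_p_series_Suc_least)
    show "subgroup {x \<in> carrier G. u x \<in> lower_p_series p G (Suc 0)} G"
      by (rule subgroupI) (auto intro!: exI[of _ \<one>])
    fix x assume "x \<in> lower_p_series p G 0"
    then have x: "x \<in> carrier G" by simp
    have ux: "u x \<in> lower_p_series p G 0" using x by simp
    show "x [^] p \<in> {x \<in> carrier G. u x \<in> lower_p_series p G (Suc 0)}"
      using x pow_in_lower_p_series_Suc[OF ux] by (simp add: u.hom_nat_pow)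
    show "commutator G x g \<in> {x \<in> carrier G. u x \<in> lower_p_series p G (Suc 0)}"
      if "g \<in> carrier G" for g
      using x that commutator_in_lower_p_series_Suc[OF ux, of "u g"]
      by (simp add: u.hom_commutator)
  qed
  then show ?thesis using x by blast
qed

lemma comm_group_Mod_lower_p_series_1: "comm_group (G Mod lower_p_series p G (Suc 0))"
proof -
  define N where "N = lower_p_series p G (Suc 0)"
  interpret normal N G unfolding N_def by (rule normal_lower_p_series)
  interpret q: group_hom G "G Mod N" "\<lambda>x. N #> x" by (rule quotient_map_hom)
  have "A \<otimes>\<^bsub>G Mod N\<^esub> B = B \<otimes>\<^bsub>G Mod N\<^esub> A" if AB: "A \<in> carrier (G Mod N)" "B \<in> carrier (G Mod N)" for A B
  proof -
    obtain x y where xy: "x \<in> carrier G" "y \<in> carrier G" "A = N #> x" "B = N #> y"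
      using AB unfolding carrier_FactGroup by blast
    have "commutator G x y \<in> N"
      using commutator_in_lower_p_series_Suc[of x p 0 y] xy by (simp add: N_def)
    then show ?thesis using commute_mod_iff[OF xy(1,2)] xy(3,4) by simp
  qed
  then show ?thesis unfolding N_def by (rule q.H.group_comm_groupI[unfolded N_def])
qed

text \<open>The quotient of \<open>G\<close> by \<open>G' G\<^sup>p\<close> is a vector space over the field with \<open>p\<close> elements of dimension at most
\<open>d\<close>, on which \<open>u\<close> induces a unipotent linear map.\<close>

lemma p_automorphism_trivial_mod_lower_p_series_1:
  assumes fin: "finite (carrier G)" and p: "Factorial_Ring.prime p" and ord: "order G = p ^ n"
    and S: "S \<subseteq> carrier G" "finite S" "card S \<le> d" "generate G S = carrier G"
    and u: "u \<in> hom G G" and pow: "\<And>x. x \<in> carrier G \<Longrightarrow> (u ^^ (p ^ k)) x = x"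
    and x: "x \<in> carrier G"
  shows "inv x \<otimes> (u ^^ (p ^ (d - 1))) x \<in> lower_p_series p G (Suc 0)"
proof -
  define N where "N = lower_p_series p G (Suc 0)"
  interpret N: normal N G unfolding N_def by (rule normal_lower_p_series)
  interpret q: group_hom G "G Mod N" "\<lambda>x. N #> x" by (rule N.quotient_map_hom)
  interpret V: comm_group "G Mod N"
    unfolding N_def by (rule comm_group_Mod_lower_p_series_1)
  have uc: "(u ^^ i) y \<in> carrier G" if "y \<in> carrier G" for i y
    by (rule hom_in_carrier[OF hom_funpow[OF u] that])
  have fin_V: "finite (carrier (G Mod N))"
    using fin by (simp add: carrier_FactGroup)
  have exp: "Y [^]\<^bsub>G Mod N\<^esub> p = \<one>\<^bsub>G Mod N\<^esub>" if Y: "Y \<in> carrier (G Mod N)" for Y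
  proof -
    obtain y where y: "y \<in> carrier G" "Y = N #> y" using Y unfolding carrier_FactGroup by blast
    have "y [^] p \<in> N" using pow_in_lower_p_series_Suc[of y p 0] y by (simp add: N_def)
    then show ?thesis
      using N.quotient_map_eq_one_iff[of "y [^] p"] q.hom_nat_pow[OF y(1), of p] y by simp
  qed
  have "order (G Mod N) dvd p ^ n"
    using lagrange[OF N.is_subgroup] ord by (metis dvd_triv_left order_def FactGroup_def partial_object.select_convs(1))
  then obtain m where m: "order (G Mod N) = p ^ m"
    using divides_primepow_nat[OF p] by auto
  have "carrier (G Mod N) = generate (G Mod N) ((\<lambda>x. N #> x) ` S)"
    using q.generate_img[OF S(1)] S(4) by (simp add: carrier_FactGroup)
  then have "order (G Mod N) \<le> p ^ card ((\<lambda>x. N #> x) ` S)"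
    using V.card_generate_le_prime_exponent[of "(\<lambda>x. N #> x) ` S" p] exp S(1,2) prime_gt_0_nat[OF p]
    by (auto simp: order_def intro!: q.hom_closed)
  also have "\<dots> \<le> p ^ d"
    using card_image_le[OF S(2), of "\<lambda>x. N #> x"] S(3) prime_gt_0_nat[OF p]
    by (intro power_increasing) auto
  finally have V_le: "order (G Mod N) \<le> p ^ d" .
  interpret qu: group_hom G "G Mod N" "\<lambda>x. N #> u x"
    using Group.hom_compose[OF u q.homh] group_axioms q.H.group_axioms
    by (simp add: group_hom_def group_hom_axioms_def comp_def)
  have ker: "N \<subseteq> kernel G (G Mod N) (\<lambda>x. N #> u x)"
  proof
    fix y assume y: "y \<in> N"
    have "u y \<in> N" using hom_lower_p_series_1[OF u] y by (simp add: N_def)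
    then show "y \<in> kernel G (G Mod N) (\<lambda>x. N #> u x)"
      using N.quotient_map_eq_one_iff[of "u y"] y by (simp add: kernel_def)
  qed
  obtain U where U: "U \<in> hom (G Mod N) (G Mod N)"
    and U_eq: "\<And>x. x \<in> carrier G \<Longrightarrow> U (N #> x) = N #> u x"
    by (rule qu.FactGroup_universal_kernel[OF N.normal_axioms ker]) blast
  have U_pow: "(U ^^ i) (N #> y) = N #> (u ^^ i) y" if "y \<in> carrier G" for i y
    using that by (induction i) (auto simp: uc simp: U_eq)
  have "(U ^^ (p ^ (d - 1))) (N #> x) = N #> x"
  proof (rule V.unipotent_pow_eq_id[OF fin_V p exp m V_le U])
    show "(U ^^ p ^ k) Y = Y" if "Y \<in> carrier (G Mod N)" for Y
      using that pow U_pow unfolding carrier_FactGroup by auto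
  qed (use x in \<open>auto intro: q.hom_closed\<close>)
  then show ?thesis
    using N.quotient_map_eq_iff[OF x uc[OF x], of "p ^ (d - 1)"] U_pow[OF x] unfolding N_def by metis
qed

lemma P_subgroup_subset_lower_p_series: "P_subgroup p G \<subseteq> lower_p_series p G (Suc 0)"
proof -
  interpret L: subgroup "lower_p_series p G (Suc 0)" G by (rule subgroup_lower_p_series)
  have "derived G (carrier G) \<subseteq> lower_p_series p G (Suc 0)"
    unfolding lower_central_1[symmetric]
    by (rule lower_central_Suc_least[OF subgroup_lower_p_series])
      (use commutator_in_lower_p_series_Suc[of _ p 0] in simp)
  moreover have "x [^] (if p = 2 then 4 else p) \<in> lower_p_series p G (Suc 0)"
    if x: "x \<in> carrier G" for x
  proof (cases "p = 2")
    case True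
    have "(x [^] p) [^] p \<in> lower_p_series p G (Suc 0)"
      using pow_in_lower_p_series_Suc[of "x [^] p" p 0] x by simp
    then show ?thesis using True x by (simp add: nat_pow_pow)
  next
    case False
    then show ?thesis using pow_in_lower_p_series_Suc[of x p 0] x by simp
  qed
  then have "power_subgroup G (if p = 2 then 4 else p) \<subseteq> lower_p_series p G (Suc 0)"
    unfolding power_subgroup_def by (intro generate_subgroup_incl[OF _ subgroup_lower_p_series]) auto
  ultimately show ?thesis
    unfolding P_subgroup_def set_mult_def by blast
qed

lemma auto_imp_hom: "u \<in> auto G \<Longrightarrow> u \<in> hom G G"
  by (simp add: auto_def)

text \<open>Automorphisms are extensional functions, so a power in the automorphism group agrees with the iterate
of the function only on the carrier. Since the results on endomorphisms concern iterates, the passage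
is made pointwise.\<close>

lemma AutoGroup_pow_apply:
  assumes u: "u \<in> auto G" and x: "x \<in> carrier G"
  shows "(u [^]\<^bsub>AutoGroup G\<^esub> (n::nat)) x = (u ^^ n) x"
  using x
proof (induction n arbitrary: x)
  case 0
  then show ?case by (simp add: AutoGroup_def BijGroup_def)
next
  case (Suc n)
  interpret A: group "AutoGroup G" by (rule AutoGroup)
  have un: "u [^]\<^bsub>AutoGroup G\<^esub> n \<in> auto G"
    using A.nat_pow_closed[of u n] u by (simp add: AutoGroup_def)
  have ux: "u x \<in> carrier G" by (rule hom_in_carrier[OF auto_imp_hom[OF u] Suc.prems])
  have "(u [^]\<^bsub>AutoGroup G\<^esub> Suc n) x = (u [^]\<^bsub>AutoGroup G\<^esub> n) (u x)"
    using u un Suc.prems by (simp add: AutoGroup_def BijGroup_def auto_def compose_def)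
  also have "\<dots> = (u ^^ Suc n) x"
    using Suc.IH[OF ux] by (simp add: funpow_swap1)
  finally show ?case .
qed

lemma AutoGroup_eq_one_iff:
  assumes u: "u \<in> auto G"
  shows "u = \<one>\<^bsub>AutoGroup G\<^esub> \<longleftrightarrow> (\<forall>x\<in>carrier G. u x = x)"
proof
  assume "\<forall>x\<in>carrier G. u x = x"
  moreover have "u \<in> extensional (carrier G)"
    using u by (simp add: auto_def Bij_def)
  ultimately show "u = \<one>\<^bsub>AutoGroup G\<^esub>"
    by (auto simp: AutoGroup_def BijGroup_def extensional_def fun_eq_iff)
qed (simp add: AutoGroup_def BijGroup_def)

lemma AutoGroup_exponent_le:
  assumes Q: "Q \<subseteq> auto G" and "0 < n"
    and pow: "\<And>u x. u \<in> Q \<Longrightarrow> x \<in> carrier G \<Longrightarrow> (u ^^ n) x = x"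
  shows "group_exponent (AutoGroup G\<lparr>carrier := Q\<rparr>) \<le> n"
  unfolding group_exponent_def
proof (rule Least_le, intro conjI ballI)
  interpret A: group "AutoGroup G" by (rule AutoGroup)
  fix u assume "u \<in> carrier (AutoGroup G\<lparr>carrier := Q\<rparr>)"
  then have u: "u \<in> Q" "u \<in> auto G" using Q by auto
  have "u [^]\<^bsub>AutoGroup G\<^esub> n \<in> auto G"
    using A.nat_pow_closed[of u n] u by (simp add: AutoGroup_def)
  then have "u [^]\<^bsub>AutoGroup G\<^esub> n = \<one>\<^bsub>AutoGroup G\<^esub>"
    using AutoGroup_eq_one_iff AutoGroup_pow_apply[OF u(2)] pow[OF u(1)] by simp
  then show "u [^]\<^bsub>AutoGroup G\<lparr>carrier := Q\<rparr>\<^esub> n = \<one>\<^bsub>AutoGroup G\<lparr>carrier := Q\<rparr>\<^esub>"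
    by (simp add: A.nat_pow_consistent[of u n Q])
qed fact

lemma funpow_card_subgroup_AutoGroup:
  assumes Q: "subgroup Q (AutoGroup G)" and u: "u \<in> Q" and x: "x \<in> carrier G"
  shows "(u ^^ card Q) x = x"
proof -
  interpret A: group "AutoGroup G" by (rule AutoGroup)
  interpret Q: group "AutoGroup G\<lparr>carrier := Q\<rparr>"
    by (rule subgroup.subgroup_is_group[OF Q AutoGroup])
  have "u \<in> auto G" using subgroup.mem_carrier[OF Q u] by (simp add: AutoGroup_def)
  have "u [^]\<^bsub>AutoGroup G\<^esub> card Q = \<one>\<^bsub>AutoGroup G\<^esub>"
    using Q.pow_order_eq_1[of u] u by (simp add: order_def A.nat_pow_consistent[of u "card Q" Q])
  then have "(u [^]\<^bsub>AutoGroup G\<^esub> card Q) x = x"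
    using x by (simp add: AutoGroup_def BijGroup_def)
  then show ?thesis using AutoGroup_pow_apply[OF \<open>u \<in> auto G\<close> x] by simp
qed

lemma funpow_power_fixed_mono:
  assumes "(u ^^ (p ^ i)) x = x" "i \<le> j"
  shows "(u ^^ (p ^ j :: nat)) x = x"
proof -
  have "(u ^^ (p ^ i)) ^^ m = u ^^ (p ^ i * m)" for m by (simp add: funpow_mult)
  moreover have "((u ^^ (p ^ i)) ^^ m) x = x" for m
    using assms(1) by (induction m) auto
  moreover have "p ^ j = p ^ i * p ^ (j - i)"
    using assms(2) by (simp flip: power_add)
  ultimately show ?thesis by metis
qed

text \<open>The series reaches the trivial group after \<open>t c\<close> steps, and \<open>u\<close> is trivial on the first factor to
begin with, so \<open>t c - 1\<close> successive \<open>p\<close>-th powers suffice. For \<open>t c > 0\<close> this number is at most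
\<open>t (t c - 1) = t\<^sup>2 c - t\<close>.\<close>

lemma endomorphism_pow_eq_id:
  assumes triv: "lower_p_series p G (t * c) = {\<one>}" and u: "u \<in> hom G G"
    and mod: "\<And>x. x \<in> carrier G \<Longrightarrow> inv x \<otimes> u x \<in> lower_p_series p G (Suc 0)"
    and x: "x \<in> carrier G"
  shows "(u ^^ (p ^ (t\<^sup>2 * c - t))) x = x"
proof (cases "t * c")
  case 0
  then have "carrier G = {\<one>}" using triv unfolding 0 by simp
  then show ?thesis using hom_in_carrier[OF hom_funpow[OF u] x] x by auto
next
  case (Suc i)
  have "inv x \<otimes> (u ^^ (p ^ i)) x = \<one>"
    using endomorphism_pow_trivial_mod_lower_p_series[OF u mod x, of i] triv Suc by simp
  then have "(u ^^ (p ^ i)) x = x"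
    using inv_mult_eq_one_iff[OF x hom_in_carrier[OF hom_funpow[OF u] x]] by simp
  moreover have "t\<^sup>2 * c - t = t * i"
    using Suc by (simp add: power2_eq_square mult.assoc)
  moreover have "i \<le> t * i" using Suc by (cases t) auto
  ultimately show ?thesis by (simp add: funpow_power_fixed_mono)
qed

lemma pow_in_derived:
  assumes fin: "finite (carrier G)" and exp: "group_exponent (G Mod (derived G (carrier G))) = n"
    and x: "x \<in> carrier G"
  shows "x [^] n \<in> derived G (carrier G)"
proof -
  interpret D: normal "derived G (carrier G)" G by (rule derived_self_is_normal)
  interpret q: group_hom G "G Mod derived G (carrier G)" "\<lambda>x. derived G (carrier G) #> x"
    by (rule D.quotient_map_hom)
  have "(derived G (carrier G) #> x) [^]\<^bsub>G Mod derived G (carrier G)\<^esub> n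
      = \<one>\<^bsub>G Mod derived G (carrier G)\<^esub>"
    unfolding exp[symmetric] using fin x
    by (intro q.H.group_exponent_pow q.hom_closed) (simp_all add: carrier_FactGroup)
  then show ?thesis
    using D.quotient_map_eq_one_iff[of "x [^] n"] q.hom_nat_pow[OF x] x by simp
qed

lemma pow_center_eq_one:
  assumes fin: "finite (carrier G)" and exp: "group_exponent (G\<lparr>carrier := center G\<rparr>) = n"
    and z: "z \<in> center G"
  shows "z [^] n = \<one>"
proof -
  have "subgroup {z \<in> carrier G. \<forall>x\<in>carrier G. x \<otimes> z = z \<otimes> x} G"
    using group_hom.subgroup_commuting_images[of G G "\<lambda>x. x" "carrier G"] group_axioms
    by (simp add: group_hom_def group_hom_axioms_def hom_def)
  moreover have "center G = {z \<in> carrier G. \<forall>x\<in>carrier G. x \<otimes> z = z \<otimes> x}"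
    unfolding center_def by auto
  ultimately have "subgroup (center G) G" by simp
  then interpret Z: group "G\<lparr>carrier := center G\<rparr>"
    by (rule subgroup.subgroup_is_group) (rule group_axioms)
  have "finite (center G)" using fin by (auto simp: center_def)
  then have "z [^]\<^bsub>G\<lparr>carrier := center G\<rparr>\<^esub> n = \<one>"
    using Z.group_exponent_pow[of z] z exp by simp
  then show ?thesis by (simp add: nat_pow_consistent[of z _ "center G"])
qed

end

theorem theoremC:
  fixes G :: "('a, 'b) monoid_scheme" and p c r s t :: nat
  assumes "Factorial_Ring.prime p"
    and "group G"
    and "finite (carrier G)"
    and "\<exists>n. order G = p ^ n"
    and "nilpotent_of_class G c"
    and "group_exponent (G Mod (derived G (carrier G))) = p ^ r"
    and "group_exponent (G\<lparr>carrier := center G\<rparr>) = p ^ s"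
    and "t = min r s"
  shows "group_exponent ((AutoGroup G)\<lparr>carrier := Aut_mod G (P_subgroup p G)\<rparr>)
           \<le> p ^ (t\<^sup>2 * c - t)
    \<and> (\<forall>d S Q. S \<subseteq> carrier G \<and> finite S \<and> card S \<le> d \<and> generate G S = carrier G
          \<and> subgroup Q (AutoGroup G) \<and> (\<exists>k. card Q = p ^ k) \<longrightarrow>
         (p > 2 \<longrightarrow> group_exponent ((AutoGroup G)\<lparr>carrier := Q\<rparr>)
                     \<le> p ^ (t\<^sup>2 * c - t + d - 1))
       \<and> (p = 2 \<longrightarrow> group_exponent ((AutoGroup G)\<lparr>carrier := Q\<rparr>)
                     \<le> p ^ (t\<^sup>2 * c - t + 2 * d - 1)))"
proof -
  interpret group G by fact
  note p = assms(1) and fin = assms(3)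
  have p0: "0 < p" using p by (rule prime_gt_0_nat)
  obtain n where n: "order G = p ^ n" using assms(4) by blast
  have nil: "lower_central G c = {\<one>\<^bsub>G\<^esub>}" using assms(5) by (simp add: nilpotent_of_class_def)
  have "t = r \<or> t = s" using assms(8) by (simp add: min_def)
  then have triv: "lower_p_series p G (t * c) = {\<one>\<^bsub>G\<^esub>}"
    using pow_in_derived[OF fin assms(6)] pow_center_eq_one[OF fin assms(7)]
    by (intro lower_p_series_trivial[OF nil]) auto
  note pow_eq_id = endomorphism_pow_eq_id[OF triv]
  show ?thesis
  proof (intro conjI allI impI)
    show "group_exponent ((AutoGroup G)\<lparr>carrier := Aut_mod G (P_subgroup p G)\<rparr>) \<le> p ^ (t\<^sup>2 * c - t)"
    proof (rule AutoGroup_exponent_le)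
      show "Aut_mod G (P_subgroup p G) \<subseteq> auto G" by (auto simp: Aut_mod_def)
      fix u x assume u: "u \<in> Aut_mod G (P_subgroup p G)" and x: "x \<in> carrier G"
      then show "(u ^^ (p ^ (t\<^sup>2 * c - t))) x = x"
        using P_subgroup_subset_lower_p_series[of p]
        by (intro pow_eq_id) (auto simp: Aut_mod_def auto_imp_hom)
    qed (use p0 in simp)
  next
    fix d S Q
    assume *: "S \<subseteq> carrier G \<and> finite S \<and> card S \<le> d \<and> generate G S = carrier G
          \<and> subgroup Q (AutoGroup G) \<and> (\<exists>k. card Q = p ^ k)"
    then obtain k where Q: "subgroup Q (AutoGroup G)" and k: "card Q = p ^ k" by blast
    have Q_auto: "Q \<subseteq> auto G"
      using subgroup.subset[OF Q] by (simp add: AutoGroup_def)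
    have bound: "group_exponent (AutoGroup G\<lparr>carrier := Q\<rparr>) \<le> p ^ e"
      if e: "t\<^sup>2 * c - t + d - 1 \<le> e" for e
    proof (rule AutoGroup_exponent_le[OF Q_auto])
      fix u x assume u: "u \<in> Q" and x: "x \<in> carrier G"
      have uh: "u \<in> hom G G" using u Q_auto auto_imp_hom by blast
      show "(u ^^ (p ^ e)) x = x"
      \<comment> \<open>for \<open>d = 0\<close> the truncated difference is no longer \<open>t\<^sup>2 c - t + (d - 1)\<close>, but then \<open>G\<close> is trivial\<close>
      proof (cases "d = 0")
        case True
        then have "carrier G = {\<one>\<^bsub>G\<^esub>}" using * by (auto simp: generate_empty)
        then show ?thesis using hom_in_carrier[OF hom_funpow[OF uh] x] x by auto
      next
        case False
        define v where "v = u ^^ (p ^ (d - 1))"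
        have v: "v \<in> hom G G" unfolding v_def by (rule hom_funpow[OF uh])
        \<comment> \<open>\<open>v\<close> is trivial on \<open>G\<close> modulo the first term, so the bound for such endomorphisms applies to it\<close>
        have "(v ^^ (p ^ (t\<^sup>2 * c - t))) x = x"
        proof (rule pow_eq_id[OF v _ x])
          fix y assume y: "y \<in> carrier G"
          show "inv\<^bsub>G\<^esub> y \<otimes>\<^bsub>G\<^esub> v y \<in> lower_p_series p G (Suc 0)"
            unfolding v_def
            using * funpow_card_subgroup_AutoGroup[OF Q u] k y
            by (intro p_automorphism_trivial_mod_lower_p_series_1[OF fin p n, of S d, where k = k] uh) auto
        qed
        then have "(u ^^ (p ^ (d - 1 + (t\<^sup>2 * c - t)))) x = x"
          by (simp add: v_def funpow_mult power_add mult.commute)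
        then show ?thesis
          by (rule funpow_power_fixed_mono) (use e False in simp)
      qed
    qed (use p0 in simp)
    show "group_exponent ((AutoGroup G)\<lparr>carrier := Q\<rparr>) \<le> p ^ (t\<^sup>2 * c - t + d - 1)"
      by (rule bound) simp
    show "group_exponent ((AutoGroup G)\<lparr>carrier := Q\<rparr>) \<le> p ^ (t\<^sup>2 * c - t + 2 * d - 1)"
      by (rule bound) simp
  qed
qed

end
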